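(* With respect to the trace $\tau\circ\mathcal{E}$, the element $X\in B\langle X,X^*\rangle$ (where $B=C[0,1]$ and $\mathcal{E}$ is the $B$-valued distribution specified in the context) is not a scalar-valued R-diagonal element.
   Context: R-diagonality: Let $D\subseteq A$ be a unital inclusion of unital $*$-algebras and $\mathcal{F}:A\to D$ a conditional expectation ($D$-bimodular unital projection). For $\epsilon=(\epsilon(1),\ldots,\epsilon(n))\in\{1,*\}^n$, the maximal alternating interval partition $\sigma(\epsilon)$ is the interval partition of $\{1,\ldots,n\}$ whose blocks are the maximal interval subsets $I$ such that $j,j+1\in I$ implies $\epsilon(j)\ne\epsilon(j+1)$. An element $a\in A$ is $D$-valued R-diagonal (with respect to $\mathcal{F}$) if (1) for every integer $k\ge0$ and $b_1,\ldots,b_{2k}\in D$, $\mathcal{F}(ab_1a^*b_2ab_3a^*\cdots b_{2k-2}ab_{2k-1}a^*b_{2k}a)=0$; and (2) for every $n\ge1$, $\epsilon\in\{1,*\}^n$ and $b_1,\ldots,b_n\in D$, $$\mathcal{F}\Big(\prod_{I\in\sigma(\epsilon)}\Big(\prod_{j\in I}b_ja^{\epsilon(j)}-\mathcal{F}\Big(\prod_{j\in I}b_ja^{\epsilon(j)}\Big)\Big)\Big)=0,$$ products being taken in order of increasing indices. Scalar-valued R-diagonality is the case $D=\mathbf{C}$ (here with $\mathcal{F}=\tau\circ\mathcal{E}$). The map $\mathcal{E}$: $B=C[0,1]$, $\tau:B\to\mathbf{C}$ is integration against Lebesgue measure, and $B\langle X,X^*\rangle$ is the $*$-algebra of polynomials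 in noncommuting variables $X,X^*$ with coefficients in $B$ (algebraic free product of $B$, $\mathbf{C}[X]$, $\mathbf{C}[X^*]$ amalgamated over the scalars). $\mathcal{E}:B\langle X,X^*\rangle\to B$ is the linear, self-adjoint, $B$-bimodular map that is the identity on $B$, with respect to which $X$ is $B$-valued R-diagonal, and whose even alternating moments are, for all $n\in\mathbf{N}$ and $b_1,\ldots,b_{2n}\in B$, $$\mathcal{E}(b_1X^*b_2X\cdots b_{2n-1}X^*b_{2n}X)=\sum_{\pi\in\mathcal{P}(n)}b_1\Lambda_\pi(b_3,b_5,\ldots,b_{2n-1})\tau\big(\Gamma_\pi(b_2,b_4,\ldots,b_{2n})\big),$$ $$\mathcal{E}(b_1Xb_2X^*\cdots b_{2n-1}Xb_{2n}X^* )=\sum_{\pi\in\mathcal{P}(n)}\Gamma_\pi(b_1,b_3,\ldots,b_{2n-1})\tau\big(\Lambda_\pi(b_2,b_4,\ldots,b_{2n-2})b_{2n}\big).$$ Here $\mathcal{P}(n)$ is the set of all set partitions of $\{1,\ldots,n\}$; $S_\pi(j)$ is the block of $\pi$ containing $j$. For $g_1,\ldots,g_n\in C[0,1]$, $$\Gamma_\pi(g_1,\ldots,g_n)=\prod_{j\in S_\pi(1)}g_j\prod_{S\in\pi\setminus\{S_\pi(1)\}}\tau\Big(\prod_{j\in S}g_j\Big).$$ Let $J_\pi=\bigcup_{S\in\pi}(S\setminus\{\max S\})$ and $I_\pi(p)=\{j\in\{1,\ldots,p\}: S_\pi(j)\not\subseteq\{1,\ldots,p\}\}$. If $J_\pi=\emptyset$,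 $\Lambda_\pi(g_1,\ldots,g_{n-1})=\prod_{j=1}^{n-1}g_j$ (equal to $1$ if $n=1$). Otherwise, for $t\in[0,1]$, $$E(\pi,t)=\Big\{(t_j)_{j\in J_\pi}\in\mathbf{R}^{J_\pi}: \forall p\in\{1,\ldots,n-1\},\ 0<t+\sum_{j\in I_\pi(p)}t_j\le1\Big\},$$ $$\Lambda_\pi(g_1,\ldots,g_{n-1})(t)=\int_{E(\pi,t)}\prod_{p=1}^{n-1}g_p\Big(t+\sum_{j\in I_\pi(p)}t_j\Big)\,d\lambda((t_j)_{j\in J_\pi}),$$ with $\lambda$ the $|J_\pi|$-dimensional Lebesgue measure.
   Formalization: The first moment formula is imposed only for t in (0,1], with the value at t=0 fixed by continuity: read literally at t=0, E(π,0) is empty for e.g. π={{1,2},{3}}, so (n=3, all b=1) the sum is 5 on (0,1] but 3 at 0, not an element of C[0,1]. *)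

theory Defs
  imports "HOL-Analysis.Analysis" "HOL-Library.Disjoint_Sets"
begin

section \<open>Unital complex star-algebras\<close>

class star_algebra = ring_1 +
  fixes cscale :: "complex \<Rightarrow> 'a \<Rightarrow> 'a"  (infixr \<open>*\<^sub>C\<close> 75)
    and star :: "'a \<Rightarrow> 'a"
  assumes cscale_add_right: "z *\<^sub>C (a + b) = z *\<^sub>C a + z *\<^sub>C b"
    and cscale_add_left: "(z + w) *\<^sub>C a = z *\<^sub>C a + w *\<^sub>C a"
    and cscale_cscale: "z *\<^sub>C (w *\<^sub>C a) = (z * w) *\<^sub>C a"
    and cscale_one: "1 *\<^sub>C a = a"
    and mult_cscale_left: "(z *\<^sub>C a) * b = z *\<^sub>C (a * b)"
    and mult_cscale_right: "a * (z *\<^sub>C b) = z *\<^sub>C (a * b)"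
    and star_star: "star (star a) = a"
    and star_add: "star (a + b) = star a + star b"
    and star_mult: "star (a * b) = star b * star a"
    and star_cscale: "star (z *\<^sub>C a) = cnj z *\<^sub>C star a"

definition clinear :: "('a::star_algebra \<Rightarrow> 'b::star_algebra) \<Rightarrow> bool"
  where "clinear f \<longleftrightarrow> (\<forall>a b. f (a + b) = f a + f b) \<and> (\<forall>z a. f (z *\<^sub>C a) = z *\<^sub>C f a)"

definition selfadjoint_map :: "('a::star_algebra \<Rightarrow> 'b::star_algebra) \<Rightarrow> bool"
  where "selfadjoint_map f \<longleftrightarrow> (\<forall>a. f (star a) = star (f a))"

definition star_hom :: "('a::star_algebra \<Rightarrow> 'b::star_algebra) \<Rightarrow> bool"
  where "star_hom f \<longleftrightarrow>
    clinear f \<and> selfadjoint_map f \<and> f 1 = 1 \<and> (\<forall>a b. f (a * b) = f a * f b)"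

text \<open>A unital inclusion \<open>D \<subseteq> A\<close> is given by an injective unital star-homomorphism
  \<open>\<iota> : D \<rightarrow> A\<close>; a conditional expectation is then a map \<open>F : A \<rightarrow> D\<close>.\<close>

definition conditional_expectation ::
    "('d::star_algebra \<Rightarrow> 'a::star_algebra) \<Rightarrow> ('a \<Rightarrow> 'd) \<Rightarrow> bool"
  where "conditional_expectation \<iota> F \<longleftrightarrow>
    star_hom \<iota> \<and> inj \<iota> \<and> clinear F \<and> (\<forall>d. F (\<iota> d) = d) \<and>
    (\<forall>d d' a. F (\<iota> d * a * \<iota> d') = d * F a * d')"

abbreviation scalar :: "complex \<Rightarrow> 'a::star_algebra"
  where "scalar z \<equiv> z *\<^sub>C 1"

instantiation complex :: star_algebra
begin
definition cscale_complex :: "complex \<Rightarrow> complex \<Rightarrow> complex" where "z *\<^sub>C w = z * w"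
definition star_complex :: "complex \<Rightarrow> complex" where "star z = cnj z"
instance
  by standard (simp_all add: cscale_complex_def star_complex_def algebra_simps)
end


section \<open>R-diagonal elements\<close>

definition block :: "nat set set \<Rightarrow> nat \<Rightarrow> nat set"
  where "block \<pi> j = (THE S. S \<in> \<pi> \<and> j \<in> S)"

definition ordered_prod :: "(nat \<Rightarrow> 'a::monoid_mult) \<Rightarrow> nat set \<Rightarrow> 'a"
  where "ordered_prod f I = prod_list (map f (sorted_list_of_set I))"

datatype exponent = One | Star

primrec exponent_pow :: "'a::star_algebra \<Rightarrow> exponent \<Rightarrow> 'a" where
  "exponent_pow a One = a"
| "exponent_pow a Star = star a"

definition alternating_interval :: "nat \<Rightarrow> (nat \<Rightarrow> exponent) \<Rightarrow> nat set \<Rightarrow> bool"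
  where "alternating_interval n \<epsilon> I \<longleftrightarrow>
    (\<exists>l u. 1 \<le> l \<and> l \<le> u \<and> u \<le> n \<and> I = {l..u}) \<and>
    (\<forall>j. j \<in> I \<and> j + 1 \<in> I \<longrightarrow> \<epsilon> j \<noteq> \<epsilon> (j + 1))"

definition max_alternating_partition :: "nat \<Rightarrow> (nat \<Rightarrow> exponent) \<Rightarrow> nat set set"
  where "max_alternating_partition n \<epsilon> =
    {I. alternating_interval n \<epsilon> I \<and>
        (\<forall>I'. alternating_interval n \<epsilon> I' \<and> I \<subseteq> I' \<longrightarrow> I' = I)}"

text \<open>Sequences indexed by \<open>{1..n}\<close> are total functions on \<open>nat\<close> of which only the values at
  \<open>1, \<dots>, n\<close> are used. In the second condition the blocks of the interval partition are
  multiplied in increasing order by letting \<open>m\<close> run through their minima.\<close>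

definition R_diagonal ::
    "('d::star_algebra \<Rightarrow> 'a::star_algebra) \<Rightarrow> ('a \<Rightarrow> 'd) \<Rightarrow> 'a \<Rightarrow> bool"
  where "R_diagonal \<iota> F a \<longleftrightarrow>
    (\<forall>(k::nat) (b :: nat \<Rightarrow> 'd).
       F (ordered_prod (\<lambda>i. a * \<iota> (b (2*i - 1)) * star a * \<iota> (b (2*i))) {1..k} * a) = 0) \<and>
    (\<forall>n\<ge>1. \<forall>(\<epsilon> :: nat \<Rightarrow> exponent) (b :: nat \<Rightarrow> 'd).
       (let \<sigma> = max_alternating_partition n \<epsilon>;
            w = (\<lambda>I. ordered_prod (\<lambda>j. \<iota> (b j) * exponent_pow a (\<epsilon> j)) I)
        in F (ordered_prod (\<lambda>m. w (block \<sigma> m) - \<iota> (F (w (block \<sigma> m)))) (Min ` \<sigma>)) = 0))"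


section \<open>The algebra \<open>C[0,1]\<close>\<close>

text \<open>Complex-valued continuous functions on the unit interval, extended by zero to the real
  line so that each of them has a unique representative.\<close>

typedef C01 =
  "{f :: real \<Rightarrow> complex. continuous_on {0..1} f \<and> (\<forall>t. t \<notin> {0..1} \<longrightarrow> f t = 0)}"
  morphisms C01_fun Abs_C01
  by (rule exI[of _ "\<lambda>_. 0"]) auto

setup_lifting type_definition_C01

lemma C01_eqI: "(\<And>t. t \<in> {0..1} \<Longrightarrow> C01_fun f t = C01_fun g t) \<Longrightarrow> f = g"
  by transfer (metis ext)

lift_definition C01_const :: "complex \<Rightarrow> C01" is "\<lambda>z t. if t \<in> {0..1} then z else 0"
  by (auto intro: continuous_on_eq[OF continuous_on_const])

instantiation C01 :: comm_ring_1
begin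
lift_definition zero_C01 :: C01 is "\<lambda>_. 0" by auto
lift_definition one_C01 :: C01 is "\<lambda>t. if t \<in> {0..1} then 1 else 0"
  by (auto intro: continuous_on_eq[OF continuous_on_const])
lift_definition plus_C01 :: "C01 \<Rightarrow> C01 \<Rightarrow> C01" is "\<lambda>f g t. f t + g t"
  by (auto intro: continuous_intros)
lift_definition minus_C01 :: "C01 \<Rightarrow> C01 \<Rightarrow> C01" is "\<lambda>f g t. f t - g t"
  by (auto intro: continuous_intros)
lift_definition uminus_C01 :: "C01 \<Rightarrow> C01" is "\<lambda>f t. - f t"
  by (auto intro: continuous_intros)
lift_definition times_C01 :: "C01 \<Rightarrow> C01 \<Rightarrow> C01" is "\<lambda>f g t. f t * g t"
  by (auto intro: continuous_intros)
instance
proof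
  show "(0::C01) \<noteq> 1"
  proof
    assume "(0::C01) = 1"
    then have "C01_fun 0 0 = C01_fun 1 0" by simp
    then show False by (simp add: zero_C01.rep_eq one_C01.rep_eq)
  qed
qed (transfer; force simp: algebra_simps)+
end

instantiation C01 :: star_algebra
begin
lift_definition cscale_C01 :: "complex \<Rightarrow> C01 \<Rightarrow> C01" is "\<lambda>z f t. z * f t"
  by (auto intro: continuous_intros)
lift_definition star_C01 :: "C01 \<Rightarrow> C01" is "\<lambda>f t. cnj (f t)"
  by (auto intro: continuous_intros)
instance
  by standard (transfer; force simp: algebra_simps)+
end

lemma C01_const_one: "C01_const 1 = 1"
  and C01_const_zero: "C01_const 0 = 0"
  and C01_const_add: "C01_const (z + w) = C01_const z + C01_const w"
  and C01_const_mult: "C01_const (z * w) = C01_const z * C01_const w"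
  and C01_const_star: "star (C01_const z) = C01_const (cnj z)"
  and C01_const_cscale: "C01_const z * f = z *\<^sub>C f"
  by (transfer; force)+


section \<open>The algebra of polynomials in noncommuting variables over \<open>C[0,1]\<close>\<close>

text \<open>The algebraic free product of \<open>C[0,1]\<close>, \<open>\<complex>[X]\<close> and \<open>\<complex>[X\<^sup>*]\<close> amalgamated over the
  scalars, given by generators and relations. Terms are identified modulo the axioms of unital
  complex algebras and the algebra structure of the coefficients; scalars are the constant
  functions, and the rule \<open>scalar_central\<close> expresses the amalgamation. The resulting universal
  property is \<open>ncpoly_universal\<close>.\<close>

datatype ncterm = TCoef C01 | TX | TXstar | TAdd ncterm ncterm | TMul ncterm ncterm

inductive nceq :: "ncterm \<Rightarrow> ncterm \<Rightarrow> bool" where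
  refl: "nceq p p"
| sym: "nceq p q \<Longrightarrow> nceq q p"
| trans: "nceq p q \<Longrightarrow> nceq q r \<Longrightarrow> nceq p r"
| add_cong: "nceq p p' \<Longrightarrow> nceq q q' \<Longrightarrow> nceq (TAdd p q) (TAdd p' q')"
| mul_cong: "nceq p p' \<Longrightarrow> nceq q q' \<Longrightarrow> nceq (TMul p q) (TMul p' q')"
| add_assoc: "nceq (TAdd (TAdd p q) r) (TAdd p (TAdd q r))"
| add_comm: "nceq (TAdd p q) (TAdd q p)"
| add_zero: "nceq (TAdd (TCoef 0) p) p"
| mul_assoc: "nceq (TMul (TMul p q) r) (TMul p (TMul q r))"
| mul_one_left: "nceq (TMul (TCoef 1) p) p"
| mul_one_right: "nceq (TMul p (TCoef 1)) p"
| mul_zero: "nceq (TMul (TCoef 0) p) (TCoef 0)"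
| distrib_left: "nceq (TMul p (TAdd q r)) (TAdd (TMul p q) (TMul p r))"
| distrib_right: "nceq (TMul (TAdd p q) r) (TAdd (TMul p r) (TMul q r))"
| coef_add: "nceq (TCoef (b + c)) (TAdd (TCoef b) (TCoef c))"
| coef_mul: "nceq (TCoef (b * c)) (TMul (TCoef b) (TCoef c))"
| scalar_central: "nceq (TMul (TCoef (C01_const z)) p) (TMul p (TCoef (C01_const z)))"

quotient_type ncpoly = ncterm / nceq
  by (intro equivpI reflpI sympI transpI) (auto intro: nceq.refl nceq.sym nceq.trans)

primrec star_term :: "ncterm \<Rightarrow> ncterm" where
  "star_term (TCoef b) = TCoef (star b)"
| "star_term TX = TXstar"
| "star_term TXstar = TX"
| "star_term (TAdd p q) = TAdd (star_term p) (star_term q)"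
| "star_term (TMul p q) = TMul (star_term q) (star_term p)"

primrec eval_term :: "(C01 \<Rightarrow> 'a::star_algebra) \<Rightarrow> 'a \<Rightarrow> ncterm \<Rightarrow> 'a" where
  "eval_term \<phi> x (TCoef b) = \<phi> b"
| "eval_term \<phi> x TX = x"
| "eval_term \<phi> x TXstar = star x"
| "eval_term \<phi> x (TAdd p q) = eval_term \<phi> x p + eval_term \<phi> x q"
| "eval_term \<phi> x (TMul p q) = eval_term \<phi> x p * eval_term \<phi> x q"

lemma star_C01_simps:
  "star (0::C01) = 0" "star (1::C01) = 1" "star (b * c) = star b * star (c::C01)"
  by (transfer; force)+

lemma nceq_star_term: "nceq p q \<Longrightarrow> nceq (star_term p) (star_term q)"
proof (induction rule: nceq.induct)
  case (mul_zero p)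
  have "nceq (TMul (star_term p) (TCoef (C01_const 0))) (TMul (TCoef (C01_const 0)) (star_term p))"
    by (intro nceq.sym[OF nceq.scalar_central])
  then show ?case
    by (simp add: star_C01_simps C01_const_zero) (metis nceq.mul_zero nceq.trans)
next
  case (coef_mul b c)
  have "nceq (TCoef (star c * star b)) (TMul (TCoef (star c)) (TCoef (star b)))"
    by (rule nceq.coef_mul)
  then show ?case by (simp add: star_C01_simps mult.commute)
qed (auto simp: star_C01_simps star_add C01_const_star intro: nceq.intros)

lemma star_hom_simps:
  assumes "star_hom f"
  shows "f (a + b) = f a + f b" "f (a * b) = f a * f b" "f 1 = 1" "f 0 = 0"
    "f (z *\<^sub>C a) = z *\<^sub>C f a" "f (star a) = star (f a)"
proof -
  show add: "f (a + b) = f a + f b" for a b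
    using assms by (auto simp: star_hom_def clinear_def)
  show "f 0 = 0" using add[of 0 0] by simp
qed (use assms in \<open>auto simp: star_hom_def clinear_def selfadjoint_map_def\<close>)

lemma nceq_eval_term:
  assumes "star_hom \<phi>"
  shows "nceq p q \<Longrightarrow> eval_term \<phi> x p = eval_term \<phi> x q"
proof (induction rule: nceq.induct)
  case (scalar_central z p)
  have "\<phi> (C01_const z) = z *\<^sub>C 1"
    using C01_const_cscale[of z 1] star_hom_simps(3,5)[OF assms] by simp
  then show ?case by (simp add: mult_cscale_left mult_cscale_right)
qed (auto simp: star_hom_simps[OF assms] algebra_simps)

lift_definition coef :: "C01 \<Rightarrow> ncpoly" is TCoef .
lift_definition X :: ncpoly is TX .

instantiation ncpoly :: ring_1
begin
lift_definition zero_ncpoly :: ncpoly is "TCoef 0" .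
lift_definition one_ncpoly :: ncpoly is "TCoef 1" .
lift_definition plus_ncpoly :: "ncpoly \<Rightarrow> ncpoly \<Rightarrow> ncpoly" is TAdd
  by (rule nceq.add_cong)
lift_definition times_ncpoly :: "ncpoly \<Rightarrow> ncpoly \<Rightarrow> ncpoly" is TMul
  by (rule nceq.mul_cong)
lift_definition uminus_ncpoly :: "ncpoly \<Rightarrow> ncpoly" is "TMul (TCoef (- 1))"
  by (intro nceq.mul_cong nceq.refl)
definition minus_ncpoly :: "ncpoly \<Rightarrow> ncpoly \<Rightarrow> ncpoly" where "p - q = p + - (q :: ncpoly)"
instance
proof
  fix a b c :: ncpoly
  show "a * b * c = a * (b * c)" by transfer (rule nceq.mul_assoc)
  show "a + b + c = a + (b + c)" by transfer (rule nceq.add_assoc)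
  show "a + b = b + a" by transfer (rule nceq.add_comm)
  show "0 + a = a" by transfer (rule nceq.add_zero)
  show "1 * a = a" by transfer (rule nceq.mul_one_left)
  show "a * 1 = a" by transfer (rule nceq.mul_one_right)
  show "(a + b) * c = a * c + b * c" by transfer (rule nceq.distrib_right)
  show "a * (b + c) = a * b + a * c" by transfer (rule nceq.distrib_left)
  show "a - b = a + - b" by (rule minus_ncpoly_def)
  show "- a + a = 0"
  proof transfer
    fix p
    have "nceq (TAdd (TMul (TCoef (- 1)) p) p) (TAdd (TMul (TCoef (- 1)) p) (TMul (TCoef 1) p))"
      by (intro nceq.add_cong nceq.refl nceq.sym[OF nceq.mul_one_left])
    also have "nceq \<dots> (TMul (TAdd (TCoef (- 1)) (TCoef 1)) p)"
      by (rule nceq.sym[OF nceq.distrib_right])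
    also (nceq.trans) have "nceq \<dots> (TMul (TCoef (- 1 + 1)) p)"
      by (intro nceq.mul_cong nceq.refl nceq.sym[OF nceq.coef_add])
    also (nceq.trans) have "nceq \<dots> (TCoef 0)" by (simp add: nceq.mul_zero)
    finally (nceq.trans) show "nceq (TAdd (TMul (TCoef (- 1)) p) p) (TCoef 0)" .
  qed
  show "(0::ncpoly) \<noteq> 1"
  proof transfer
    have "star_hom (\<lambda>b::C01. b)" by (simp add: star_hom_def clinear_def selfadjoint_map_def)
    from nceq_eval_term[OF this] show "\<not> nceq (TCoef 0) (TCoef 1)"
      by (metis eval_term.simps(1) zero_neq_one)
  qed
qed
end

lemma coef_zero: "coef 0 = 0"
  and coef_one: "coef 1 = 1"
  and coef_add: "coef (b + c) = coef b + coef c"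
  and coef_mult: "coef (b * c) = coef b * coef c"
  and coef_const_central: "coef (C01_const z) * p = p * coef (C01_const z)"
  by (transfer; auto intro: nceq.intros)+

instantiation ncpoly :: star_algebra
begin
definition cscale_ncpoly :: "complex \<Rightarrow> ncpoly \<Rightarrow> ncpoly" where "z *\<^sub>C p = coef (C01_const z) * p"
lift_definition star_ncpoly :: "ncpoly \<Rightarrow> ncpoly" is star_term
  by (rule nceq_star_term)
instance
proof
  fix a b :: ncpoly and z w :: complex
  show "z *\<^sub>C (a + b) = z *\<^sub>C a + z *\<^sub>C b" "(z + w) *\<^sub>C a = z *\<^sub>C a + w *\<^sub>C a"
    "z *\<^sub>C w *\<^sub>C a = (z * w) *\<^sub>C a" "1 *\<^sub>C a = a" "(z *\<^sub>C a) * b = z *\<^sub>C (a * b)"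
    by (simp_all add: cscale_ncpoly_def ring_distribs mult.assoc coef_add coef_mult
        coef_one C01_const_add C01_const_mult C01_const_one)
  show "a * (z *\<^sub>C b) = z *\<^sub>C (a * b)"
    unfolding cscale_ncpoly_def by (metis coef_const_central mult.assoc)
  show "star (star a) = a"
  proof transfer
    fix p
    have "star_term (star_term p) = p" by (induction p) (simp_all add: star_star)
    then show "nceq (star_term (star_term p)) p" by (simp add: nceq.refl)
  qed
  show "star (a + b) = star a + star b" by transfer (simp add: nceq.refl)
  show *: "star (a * b) = star b * star a" for a b :: ncpoly by transfer (simp add: nceq.refl)
  have "star (coef (C01_const z)) = coef (C01_const (cnj z))"
    by transfer (simp add: C01_const_star nceq.refl)
  then show "star (z *\<^sub>C a) = cnj z *\<^sub>C star a"
    unfolding cscale_ncpoly_def * by (simp add: coef_const_central)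
qed
end

lemma star_coef: "star (coef b) = coef (star b)"
  by transfer (simp add: nceq.refl)

lemma star_hom_coef: "star_hom coef"
proof -
  have "coef (z *\<^sub>C b) = z *\<^sub>C coef b" for z b
    by (simp add: cscale_ncpoly_def coef_mult flip: C01_const_cscale)
  then show ?thesis
    by (simp add: star_hom_def clinear_def selfadjoint_map_def coef_add coef_mult coef_one star_coef)
qed

theorem ncpoly_universal:
  fixes \<phi> :: "C01 \<Rightarrow> 'a::star_algebra" and x :: 'a
  assumes "star_hom \<phi>"
  shows "\<exists>!\<psi>. star_hom \<psi> \<and> (\<forall>b. \<psi> (coef b) = \<phi> b) \<and> \<psi> X = x"
proof
  define \<psi> where "\<psi> p = eval_term \<phi> x (rep_ncpoly p)" for p
  have abs: "\<psi> (abs_ncpoly p) = eval_term \<phi> x p" for p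
    unfolding \<psi>_def
    by (metis Quotient3_ncpoly assms nceq_eval_term Quotient3_rep_abs nceq.refl)
  have add: "\<psi> (p + q) = \<psi> p + \<psi> q" for p q
    by (metis (no_types) Quotient3_abs_rep Quotient3_ncpoly abs eval_term.simps(4) plus_ncpoly.abs_eq)
  have mul: "\<psi> (p * q) = \<psi> p * \<psi> q" for p q
    by (metis (no_types) Quotient3_abs_rep Quotient3_ncpoly abs eval_term.simps(5) times_ncpoly.abs_eq)
  have co: "\<psi> (coef b) = \<phi> b" for b by (simp add: abs coef.abs_eq)
  have X: "\<psi> X = x" by (simp add: abs X.abs_eq)
  have cs: "\<psi> (z *\<^sub>C p) = z *\<^sub>C \<psi> p" for z p
  proof -
    have "\<phi> (C01_const z) = z *\<^sub>C 1"
      using C01_const_cscale[of z 1] star_hom_simps(3,5)[OF assms] by simp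
    then show ?thesis by (simp add: cscale_ncpoly_def mul co mult_cscale_left)
  qed
  have st: "\<psi> (star p) = star (\<psi> p)" for p
  proof -
    have "eval_term \<phi> x (star_term q) = star (eval_term \<phi> x q)" for q
      by (induction q)
         (simp_all add: star_hom_simps[OF assms] star_add star_mult star_star)
    then show ?thesis
      by (metis (no_types) Quotient3_abs_rep Quotient3_ncpoly abs star_ncpoly.abs_eq)
  qed
  show "star_hom \<psi> \<and> (\<forall>b. \<psi> (coef b) = \<phi> b) \<and> \<psi> X = x"
    using add mul cs st co[of 1] star_hom_simps(3)[OF assms]
    by (simp add: star_hom_def clinear_def selfadjoint_map_def co X coef_one)
  fix \<psi>' assume \<psi>': "star_hom \<psi>' \<and> (\<forall>b. \<psi>' (coef b) = \<phi> b) \<and> \<psi>' X = x"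
  have "\<psi>' (abs_ncpoly p) = eval_term \<phi> x p" for p
  proof (induction p)
    case TXstar
    have "abs_ncpoly TXstar = star X" by (simp add: X.abs_eq star_ncpoly.abs_eq)
    then show ?case using \<psi>' star_hom_simps(6) by fastforce
  next
    case (TAdd p q)
    then show ?case using \<psi>' star_hom_simps(1) by (fastforce simp flip: plus_ncpoly.abs_eq)
  next
    case (TMul p q)
    then show ?case using \<psi>' star_hom_simps(2) by (fastforce simp flip: times_ncpoly.abs_eq)
  qed (use \<psi>' in \<open>simp_all flip: coef.abs_eq X.abs_eq\<close>)
  then show "\<psi>' = \<psi>"
    by (metis (no_types) Quotient3_abs_rep Quotient3_ncpoly abs ext)
qed

lemma inj_coef: "inj coef"
proof -
  have "star_hom (\<lambda>b::C01. b)" by (simp add: star_hom_def clinear_def selfadjoint_map_def)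
  then obtain \<psi> :: "ncpoly \<Rightarrow> C01" where "\<forall>b. \<psi> (coef b) = b"
    using ncpoly_universal[of "\<lambda>b. b" 0] by blast
  then show ?thesis by (metis injI)
qed


section \<open>The moments\<close>

definition integral01 :: "(real \<Rightarrow> complex) \<Rightarrow> complex"
  where "integral01 f = (LINT t:{0..1}|lborel. f t)"

definition tau :: "C01 \<Rightarrow> complex"
  where "tau f = integral01 (C01_fun f)"

lemma conditional_expectation_tau:
  assumes "conditional_expectation coef E"
  shows "conditional_expectation scalar (tau \<circ> E)"
proof -
  have int: "set_integrable lborel {0..1} (C01_fun f)" for f
    using C01_fun[of f] by (auto intro: borel_integrable_atLeastAtMost')
  have tau_add: "tau (f + g) = tau f + tau g" for f g
    using int by (simp add: tau_def integral01_def plus_C01.rep_eq set_integral_add)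
  have tau_cscale: "tau (z *\<^sub>C f) = z * tau f" for z f
    by (simp add: tau_def integral01_def cscale_C01.rep_eq)
  have "tau 1 = (LINT t:{0..1::real}|lborel. 1)"
    unfolding tau_def integral01_def set_lebesgue_integral_def
    by (intro arg_cong[where f = "lebesgue_integral lborel"] ext)
       (auto simp: one_C01.rep_eq indicator_def)
  then have tau_one: "tau 1 = 1"
    by (simp add: set_lebesgue_integral_def)
  have E: "E (a + b) = E a + E b" "E (z *\<^sub>C a) = z *\<^sub>C E a" "E 1 = 1" for a b z
    using assms coef_one unfolding conditional_expectation_def clinear_def by metis+
  have "inj (scalar :: complex \<Rightarrow> ncpoly)"
  proof (rule injI)
    fix z w :: complex assume "scalar z = (scalar w :: ncpoly)"
    then have "tau (E (scalar z)) = tau (E (scalar w))" by simp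
    then show "z = w" by (simp add: E tau_cscale tau_one)
  qed
  moreover have "star (1 :: ncpoly) = 1"
    by (metis mult_1_left mult_1_right star_mult star_star)
  then have "star_hom (scalar :: complex \<Rightarrow> ncpoly)"
    by (simp add: star_hom_def clinear_def selfadjoint_map_def cscale_add_left cscale_cscale
        cscale_one mult_cscale_left star_cscale cscale_complex_def star_complex_def)
  ultimately show ?thesis
    by (simp add: conditional_expectation_def clinear_def E tau_add tau_cscale tau_one
        cscale_complex_def mult_cscale_left mult_cscale_right)
qed

definition set_partitions :: "nat \<Rightarrow> nat set set set"
  where "set_partitions n = {\<pi>. partition_on {1..n} \<pi>}"

definition Gam :: "nat set set \<Rightarrow> (nat \<Rightarrow> C01) \<Rightarrow> C01"
  where "Gam \<pi> g =
    (\<Prod>S\<in>\<pi> - {block \<pi> 1}. tau (\<Prod>j\<in>S. g j)) *\<^sub>C (\<Prod>j\<in>block \<pi> 1. g j)"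

definition J_set :: "nat set set \<Rightarrow> nat set"
  where "J_set \<pi> = (\<Union>S\<in>\<pi>. S - {Max S})"

definition I_set :: "nat set set \<Rightarrow> nat \<Rightarrow> nat set"
  where "I_set \<pi> p = {j \<in> {1..p}. \<not> block \<pi> j \<subseteq> {1..p}}"

text \<open>\<open>\<real>\<^sup>J\<close> is rendered as the space of the product measure \<open>\<Pi>\<^sub>M j\<in>J. lborel\<close>.\<close>

definition E_set :: "nat \<Rightarrow> nat set set \<Rightarrow> real \<Rightarrow> (nat \<Rightarrow> real) set"
  where "E_set n \<pi> t =
    {s \<in> J_set \<pi> \<rightarrow>\<^sub>E UNIV. \<forall>p\<in>{1..n-1}.
       0 < t + (\<Sum>j\<in>I_set \<pi> p. s j) \<and> t + (\<Sum>j\<in>I_set \<pi> p. s j) \<le> 1}"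

definition Lam :: "nat \<Rightarrow> nat set set \<Rightarrow> (nat \<Rightarrow> C01) \<Rightarrow> real \<Rightarrow> complex"
  where "Lam n \<pi> g t =
    (if J_set \<pi> = {} then \<Prod>p\<in>{1..n-1}. C01_fun (g p) t
     else LINT s:E_set n \<pi> t|(\<Pi>\<^sub>M j\<in>J_set \<pi>. lborel).
            \<Prod>p\<in>{1..n-1}. C01_fun (g p) (t + (\<Sum>j\<in>I_set \<pi> p. s j)))"

text \<open>\<open>Lam n \<pi> g\<close> is continuous on \<open>(0,1]\<close> and extends continuously to \<open>0\<close>, but the formula
  itself can take a wrong value at \<open>t = 0\<close>: whenever \<open>J_set \<pi> \<noteq> {}\<close> and \<open>I_set \<pi> p = {}\<close> for some
  \<open>p < n\<close>, the strict inequality in \<open>E_set\<close> makes \<open>E_set n \<pi> 0\<close> empty (for example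
  \<open>\<pi> = {{1,2},{3}}\<close>). The moment formula is therefore imposed on \<open>(0,1]\<close>; since \<open>E\<close>
  takes values in \<open>C[0,1]\<close>, this determines the value at \<open>0\<close> as the limit.\<close>

definition moments_Xstar_X :: "(ncpoly \<Rightarrow> C01) \<Rightarrow> bool"
  where "moments_Xstar_X E \<longleftrightarrow>
    (\<forall>n\<ge>1. \<forall>b :: nat \<Rightarrow> C01. \<forall>t\<in>{0<..1}.
       C01_fun (E (ordered_prod (\<lambda>i. coef (b (2*i - 1)) * star X * coef (b (2*i)) * X) {1..n})) t =
       (\<Sum>\<pi>\<in>set_partitions n.
          C01_fun (b 1) t * Lam n \<pi> (\<lambda>p. b (2*p + 1)) t * tau (Gam \<pi> (\<lambda>j. b (2*j)))))"

definition moments_X_Xstar :: "(ncpoly \<Rightarrow> C01) \<Rightarrow> bool"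
  where "moments_X_Xstar E \<longleftrightarrow>
    (\<forall>n\<ge>1. \<forall>b :: nat \<Rightarrow> C01.
       E (ordered_prod (\<lambda>i. coef (b (2*i - 1)) * X * coef (b (2*i)) * star X) {1..n}) =
       (\<Sum>\<pi>\<in>set_partitions n.
          integral01 (\<lambda>t. Lam n \<pi> (\<lambda>p. b (2*p)) t * C01_fun (b (2*n)) t)
            *\<^sub>C Gam \<pi> (\<lambda>j. b (2*j - 1))))"

end

theory Submission
  imports Defs
begin

text \<open>
  Write \<open>Q = (X X\<^sup>*)\<^sup>2\<close> and \<open>P = (X\<^sup>* X)\<^sup>4\<close>. Scalar R-diagonality would make
  \<open>\<tau>(\<E>(Q\<degree> P\<degree> Q\<degree> P\<degree>))\<close> vanish, where \<open>\<degree>\<close> denotes centring with respect to \<open>\<tau> \<circ> \<E>\<close>. This moment is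
  computed from the \<open>B\<close>-valued structure and turns out to be nonzero.

  The difference between the two kinds of centring is that \<open>\<E>(Q)\<close> is a scalar, whereas
  \<open>h = \<E>(P)\<close> is not: with \<open>f = h - \<tau>(h)\<close> one has \<open>P\<degree> = p + f\<close>, where \<open>p = P - h\<close> is centred with
  respect to \<open>\<E>\<close>. Expanding the product, \<open>B\<close>-valued R-diagonality (used through
  \<open>R_diagonal_words\<close>) kills every term that contains \<open>p\<close>, and what remains is
  \<open>\<E>(q f q f)\<close> with \<open>q = Q\<degree>\<close>. The moment formula gives \<open>\<E>(q f q) = \<gamma> f\<close> with a scalar \<open>\<gamma>\<close>, so
  the moment in question is \<open>\<gamma> \<tau>(f\<^sup>2)\<close>.

  That neither \<open>f\<close> nor \<open>\<gamma>\<close> vanishes is due to a single partition. If \<open>\<pi>\<close> is noncrossing, then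
  \<open>\<Lambda>\<^sub>\<pi>(1,\<dots>,1) = 1\<close>: the intervals \<open>{j..<max S\<^sub>\<pi>(j)}\<close> on which the variables \<open>t\<^sub>j\<close> occur form a
  laminar family, so that the variables can be integrated out one after the other, the last one
  first, each over an interval of length one (\<open>emeasure_window_region_laminar\<close>). On four points
  there is exactly one crossing partition, \<open>{{1,3},{2,4}}\<close>, and for it
  \<open>\<Lambda>\<^sub>\<pi>(1,1,1)(t) = 1/2 + t - t\<^sup>2\<close> (\<open>Lam_crossing4\<close>), which has mean \<open>2/3\<close>. Hence \<open>h\<close> is \<open>t - t\<^sup>2\<close>
  up to a constant, and \<open>\<gamma> = N + 2/3 - K\<^sup>2\<close> with natural numbers \<open>N\<close> and \<open>K\<close> that count
  partitions; whatever these are, \<open>N + 2/3\<close> is not an integer.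
\<close>


section \<open>R-diagonality and alternating words\<close>

definition word :: "('d::star_algebra \<Rightarrow> 'a::star_algebra) \<Rightarrow> 'a \<Rightarrow> ('d \<times> exponent) list \<Rightarrow> 'a"
  where "word \<iota> a w = prod_list (map (\<lambda>(b, e). \<iota> b * exponent_pow a e) w)"

text \<open>An alternating interval cannot extend across a position where the exponent is repeated. If all
  interior cut points of \<open>0 = s 0 < \<dots> < s m = n\<close> are such positions, every alternating interval
  therefore stays inside the piece that it meets, and the pieces are the maximal ones.\<close>

lemma max_alternating_partition_eq:
  fixes s :: "nat \<Rightarrow> nat"
  assumes s0: "s 0 = 0" and sm: "s m = n"
    and less: "\<And>k. k < m \<Longrightarrow> s k < s (Suc k)"
    and alt: "\<And>k j. k < m \<Longrightarrow> s k < j \<Longrightarrow> j < s (Suc k) \<Longrightarrow> \<epsilon> j \<noteq> \<epsilon> (Suc j)"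
    and eq: "\<And>k. 0 < k \<Longrightarrow> k < m \<Longrightarrow> \<epsilon> (s k) = \<epsilon> (Suc (s k))"
  shows "max_alternating_partition n \<epsilon> = (\<lambda>k. {Suc (s k)..s (Suc k)}) ` {..<m}"
proof -
  have mono: "s i \<le> s j" if "i \<le> j" "j \<le> m" for i j
    using that
  proof (induction j rule: dec_induct)
    case (step j)
    then show ?case using less[of j] by simp
  qed simp
  have alt_I: "alternating_interval n \<epsilon> {Suc (s k)..s (Suc k)}" if "k < m" for k
    unfolding alternating_interval_def
    using that less[of k] mono[of "Suc k" m] sm alt[of k]
    by (intro conjI exI[of _ "Suc (s k)"] exI[of _ "s (Suc k)"]) auto
  have cover: "\<exists>k<m. s k < l \<and> l \<le> s (Suc k)" if "1 \<le> l" "l \<le> n" for l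
  proof -
    define k where "k = (LEAST k. l \<le> s k)"
    have k: "l \<le> s k" "k \<le> m"
      unfolding k_def using that sm by (auto intro: LeastI[of _ m] Least_le)
    then obtain k' where k': "k = Suc k'" using s0 \<open>1 \<le> l\<close> by (cases k) auto
    have "\<not> l \<le> s k'" using not_less_Least[of k' "\<lambda>k. l \<le> s k"] k' by (simp add: k_def)
    then show ?thesis using k k' by (intro exI[of _ k']) auto
  qed
  have bound: "I \<subseteq> {Suc (s k)..s (Suc k)}"
    if "alternating_interval n \<epsilon> I" "k < m" "I \<inter> {Suc (s k)..s (Suc k)} \<noteq> {}" for I k
  proof -
    from that(1) obtain l u where lu: "1 \<le> l" "l \<le> u" "u \<le> n" "I = {l..u}"
      and a: "\<And>j. j \<in> I \<Longrightarrow> j + 1 \<in> I \<Longrightarrow> \<epsilon> j \<noteq> \<epsilon> (j + 1)"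
      unfolding alternating_interval_def by blast
    from that(3) lu have i: "l \<le> s (Suc k)" "Suc (s k) \<le> u" by auto
    have "\<not> l \<le> s k"
    proof
      assume l: "l \<le> s k"
      then have "k > 0" using s0 lu(1) by (cases k) auto
      then show False using eq[of k] a[of "s k"] l i lu that(2) by auto
    qed
    moreover have "\<not> s (Suc k) < u"
    proof
      assume u: "s (Suc k) < u"
      then have "Suc k < m" using sm lu(3) that(2) by (cases "Suc k = m") auto
      then show False using eq[of "Suc k"] a[of "s (Suc k)"] u i lu by auto
    qed
    ultimately show ?thesis using lu by auto
  qed
  show ?thesis
  proof (intro equalityI subsetI)
    fix I assume I: "I \<in> max_alternating_partition n \<epsilon>"
    then have ai: "alternating_interval n \<epsilon> I"
      and mx: "\<And>I'. alternating_interval n \<epsilon> I' \<Longrightarrow> I \<subseteq> I' \<Longrightarrow> I' = I"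
      by (auto simp: max_alternating_partition_def)
    from ai obtain l u where lu: "1 \<le> l" "l \<le> u" "u \<le> n" "I = {l..u}"
      unfolding alternating_interval_def by blast
    from cover[of l] lu obtain k where k: "k < m" "s k < l" "l \<le> s (Suc k)" by auto
    have "I \<subseteq> {Suc (s k)..s (Suc k)}" using bound[OF ai k(1)] k lu by fastforce
    then show "I \<in> (\<lambda>k. {Suc (s k)..s (Suc k)}) ` {..<m}"
      using mx[OF alt_I[OF k(1)]] k(1) by auto
  next
    fix I assume "I \<in> (\<lambda>k. {Suc (s k)..s (Suc k)}) ` {..<m}"
    then obtain k where k: "k < m" "I = {Suc (s k)..s (Suc k)}" by auto
    have "I' = I" if "alternating_interval n \<epsilon> I'" "I \<subseteq> I'" for I'
    proof -
      have "I' \<inter> {Suc (s k)..s (Suc k)} \<noteq> {}" using that(2) k less[of k] by fastforce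
      then show ?thesis using bound[OF that(1) k(1)] that(2) k(2) by auto
    qed
    then show "I \<in> max_alternating_partition n \<epsilon>"
      using alt_I[OF k(1)] k(2) by (auto simp: max_alternating_partition_def)
  qed
qed

text \<open>R-diagonality in a form that does not mention positions: the blocks of the partition are given
  as a list of alternating words, and maximality of the blocks becomes the requirement that each
  word begins with the exponent with which its predecessor ends.\<close>

lemma R_diagonal_words:
  assumes R: "R_diagonal \<iota> F a" and ne: "ws \<noteq> []"
    and alt: "\<forall>w\<in>set ws. w \<noteq> [] \<and> successively (\<lambda>x y. snd x \<noteq> snd y) w"
    and meet: "successively (\<lambda>v w. snd (last v) = snd (hd w)) ws"
  shows "F (prod_list (map (\<lambda>w. word \<iota> a w - \<iota> (F (word \<iota> a w))) ws)) = 0"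
proof -
  define xs where "xs = concat ws"
  define m where "m = length ws"
  \<comment> \<open>The cut points between consecutive words in the concatenation.\<close>
  define s where "s k = length (concat (take k ws))" for k
  define b where "b j = fst (xs ! (j - 1))" for j
  define \<epsilon> where "\<epsilon> j = snd (xs ! (j - 1))" for j
  define n where "n = length xs"
  have sSuc: "s (Suc k) = s k + length (ws ! k)" if "k < m" for k
    using that by (simp add: s_def m_def take_Suc_conv_app_nth)
  have nth: "xs ! (s k + i) = ws ! k ! i" if "k < m" "i < length (ws ! k)" for k i
  proof -
    have "xs = concat (take k ws) @ ws ! k @ concat (drop (Suc k) ws)"
      unfolding xs_def using id_take_nth_drop[of k ws] that(1) m_def
      by (metis append.assoc concat.simps(2) concat_append append_Cons append_Nil)
    then show ?thesis using that(2) by (simp add: s_def nth_append)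
  qed
  have ws: "ws ! k \<noteq> []" "length (ws ! k) > 0" if "k < m" for k
    using alt[rule_format, of "ws ! k"] that by (auto simp: m_def)
  have less: "s k < s (Suc k)" if "k < m" for k using sSuc ws that by simp
  have mono: "s i < s j" if "i < j" "j \<le> m" for i j
    using that
  proof (induction j rule: less_induct)
    case (less j)
    then obtain j' where j': "j = Suc j'" "i \<le> j'" by (cases j) auto
    with less have "s i \<le> s j'" by (cases "i = j'") (auto intro: less_imp_le)
    then show ?case using \<open>\<And>k. k < m \<Longrightarrow> s k < s (Suc k)\<close>[of j'] j' less.prems by simp
  qed
  have \<sigma>: "max_alternating_partition n \<epsilon> = (\<lambda>k. {Suc (s k)..s (Suc k)}) ` {..<m}"
  proof (rule max_alternating_partition_eq)
    show "s 0 = 0" "s m = n" by (simp_all add: s_def m_def n_def xs_def)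
    show "\<epsilon> j \<noteq> \<epsilon> (Suc j)" if "k < m" "s k < j" "j < s (Suc k)" for k j
    proof -
      define i where "i = j - Suc (s k)"
      have j: "j = Suc (s k + i)" "Suc i < length (ws ! k)"
        using that sSuc[OF that(1)] by (auto simp: i_def)
      have "snd (ws ! k ! i) \<noteq> snd (ws ! k ! Suc i)"
        using alt[rule_format, of "ws ! k"] that(1) j(2) by (auto simp: m_def successively_conv_nth)
      then show ?thesis
        using nth[OF that(1), of i] nth[OF that(1), of "Suc i"] j by (simp add: \<epsilon>_def)
    qed
    show "\<epsilon> (s k) = \<epsilon> (Suc (s k))" if "0 < k" "k < m" for k
    proof -
      obtain l where l: "k = Suc l" using \<open>0 < k\<close> by (cases k) auto
      have "snd (last (ws ! l)) = snd (hd (ws ! k))"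
        using meet that(2) l by (simp add: successively_conv_nth m_def)
      moreover have "xs ! (s k - 1) = last (ws ! l)"
        using nth[of l "length (ws ! l) - 1"] sSuc[of l] ws[of l] l that
        by (cases "length (ws ! l)") (auto simp: last_conv_nth)
      moreover have "xs ! s k = hd (ws ! k)"
        using nth[of k 0] ws[of k] that by (simp add: hd_conv_nth)
      ultimately show ?thesis by (simp add: \<epsilon>_def)
    qed
  qed (fact less)
  have Min: "Min {Suc (s k)..s (Suc k)} = Suc (s k)" if "k < m" for k
    using less[OF that] by (intro Min_eqI) auto
  have block: "block (max_alternating_partition n \<epsilon>) (Suc (s k)) = {Suc (s k)..s (Suc k)}"
    if "k < m" for k
    unfolding block_def
  proof (rule the_equality)
    fix S assume "S \<in> max_alternating_partition n \<epsilon> \<and> Suc (s k) \<in> S"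
    then obtain l where l: "l < m" "S = {Suc (s l)..s (Suc l)}" "s l \<le> s k" "s k < s (Suc l)"
      by (auto simp: \<sigma>)
    then have "l = k"
      using mono[of k l] mono[of "Suc l" k] that by (cases l k rule: linorder_cases)
        (auto, metis Suc_lessI less_irrefl order.strict_trans less_imp_le)
    then show "S = {Suc (s k)..s (Suc k)}" using l by simp
  qed (use that less[OF that] in \<open>auto simp: \<sigma>\<close>)
  define g where "g j = \<iota> (b j) * exponent_pow a (\<epsilon> j)" for j
  have word: "ordered_prod g {Suc (s k)..s (Suc k)} = word \<iota> a (ws ! k)" if "k < m" for k
  proof -
    have "sorted_list_of_set {Suc (s k)..s (Suc k)} = [Suc (s k)..<Suc (s (Suc k))]"
      by (metis atLeastLessThanSuc_atLeastAtMost sorted_list_of_set_range)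
    moreover have "map g [Suc (s k)..<Suc (s (Suc k))]
        = map (\<lambda>(b, e). \<iota> b * exponent_pow a e) (ws ! k)"
      using sSuc[OF that] nth[OF that]
      by (intro nth_equalityI) (auto simp: g_def b_def \<epsilon>_def nth_append split_beta simp del: upt_Suc)
    ultimately show ?thesis by (simp add: ordered_prod_def word_def)
  qed
  have minima: "sorted_list_of_set (Min ` max_alternating_partition n \<epsilon>) = map (\<lambda>k. Suc (s k)) [0..<m]"
  proof -
    have "sorted_wrt (<) (map (\<lambda>k. Suc (s k)) [0..<m])"
      using mono by (auto simp: sorted_wrt_iff_nth_less)
    moreover have "Min ` max_alternating_partition n \<epsilon> = set (map (\<lambda>k. Suc (s k)) [0..<m])"
      using Min by (force simp: \<sigma>)
    ultimately show ?thesis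
      by (metis sorted_list_of_set.idem_if_sorted_distinct strict_sorted_iff)
  qed
  have "n \<ge> 1" using ws[of 0] ne sSuc[of 0] nth[of 0 0]
    by (cases ws) (auto simp: n_def xs_def m_def Suc_le_eq)
  then have "F (ordered_prod (\<lambda>k. ordered_prod g (block (max_alternating_partition n \<epsilon>) k)
       - \<iota> (F (ordered_prod g (block (max_alternating_partition n \<epsilon>) k))))
       (Min ` max_alternating_partition n \<epsilon>)) = 0"
    using R unfolding R_diagonal_def Let_def g_def by blast
  also have "ordered_prod (\<lambda>k. ordered_prod g (block (max_alternating_partition n \<epsilon>) k)
       - \<iota> (F (ordered_prod g (block (max_alternating_partition n \<epsilon>) k))))
       (Min ` max_alternating_partition n \<epsilon>)
     = prod_list (map (\<lambda>k. word \<iota> a (ws ! k) - \<iota> (F (word \<iota> a (ws ! k)))) [0..<m])"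
    unfolding ordered_prod_def[where I = "Min ` max_alternating_partition n \<epsilon>"] minima
    by (intro arg_cong[where f = prod_list]) (auto simp: block word)
  also have "map (\<lambda>k. word \<iota> a (ws ! k) - \<iota> (F (word \<iota> a (ws ! k)))) [0..<m]
     = map (\<lambda>w. word \<iota> a w - \<iota> (F (word \<iota> a w))) ws"
    by (intro nth_equalityI) (auto simp: m_def)
  finally show ?thesis .
qed


section \<open>Volumes of window regions\<close>

text \<open>The region \<open>E(\<pi>, t)\<close> detached from partitions: the variable \<open>s j\<close> is present in the partial
  sums at the positions \<open>p\<close> with \<open>j \<le> p < M j\<close>, and \<open>R\<close> is the set of positions at which the
  window \<open>(0, 1]\<close> is imposed. Removing a variable together with its positions leads to a region of
  the same kind, which is what the induction below needs.\<close>

definition window_region :: "nat set \<Rightarrow> (nat \<Rightarrow> nat) \<Rightarrow> nat set \<Rightarrow> real \<Rightarrow> (nat \<Rightarrow> real) set"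
  where "window_region J M R t =
    {s \<in> J \<rightarrow>\<^sub>E UNIV. \<forall>p\<in>R. t + (\<Sum>j\<in>{j\<in>J. j \<le> p \<and> p < M j}. s j) \<in> {0<..1}}"

lemma window_region_sets:
  assumes "finite J" "finite R"
  shows "window_region J M R t \<in> sets (\<Pi>\<^sub>M j\<in>J. lborel)"
proof -
  have "window_region J M R t = {s \<in> space (\<Pi>\<^sub>M j\<in>J. lborel).
      \<forall>p\<in>R. t + (\<Sum>j\<in>{j\<in>J. j \<le> p \<and> p < M j}. s j) \<in> {0<..1}}"
    by (simp add: window_region_def space_PiM)
  also have "\<dots> \<in> sets (\<Pi>\<^sub>M j\<in>J. lborel)"
    using assms by measurable
  finally show ?thesis .
qed

lemma emeasure_PiM_insert:
  fixes i :: nat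
  assumes "finite J" "i \<notin> J" and A: "A \<in> sets (\<Pi>\<^sub>M j\<in>insert i J. (lborel :: real measure))"
  shows "emeasure (\<Pi>\<^sub>M j\<in>insert i J. lborel) A =
    (\<integral>\<^sup>+ s. emeasure lborel {x. s(i := x) \<in> A} \<partial>(\<Pi>\<^sub>M j\<in>J. lborel))"
proof -
  interpret product_sigma_finite "\<lambda>_::nat. lborel :: real measure" ..
  have "emeasure (\<Pi>\<^sub>M j\<in>insert i J. lborel) A = (\<integral>\<^sup>+ s. indicator A s \<partial>(\<Pi>\<^sub>M j\<in>insert i J. lborel))"
    using A by simp
  also have "\<dots> = (\<integral>\<^sup>+ s. (\<integral>\<^sup>+ x. indicator A (s(i := x)) \<partial>lborel) \<partial>(\<Pi>\<^sub>M j\<in>J. lborel))"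
    using assms by (intro product_nn_integral_insert) auto
  also have "\<dots> = (\<integral>\<^sup>+ s. emeasure lborel {x. s(i := x) \<in> A} \<partial>(\<Pi>\<^sub>M j\<in>J. lborel))"
  proof (intro nn_integral_cong)
    fix s :: "nat \<Rightarrow> real" assume s: "s \<in> space (\<Pi>\<^sub>M j\<in>J. lborel)"
    have "(\<lambda>x. s(i := x)) \<in> measurable lborel (\<Pi>\<^sub>M j\<in>insert i J. lborel)"
      using s assms by (intro measurable_fun_upd[where J = J]) auto
    from measurable_sets[OF this A] have "{x. s(i := x) \<in> A} \<in> sets lborel"
      by (simp add: vimage_def)
    then show "(\<integral>\<^sup>+ x. indicator A (s(i := x)) \<partial>lborel) = emeasure lborel {x. s(i := x) \<in> A}"
      by (simp add: indicator_def flip: nn_integral_indicator)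
  qed
  finally show ?thesis .
qed

text \<open>Consider the largest variable \<open>j\<close>. By laminarity every other variable is present either at all
  positions of \<open>{j..<M j}\<close> or at none of them. All windows that involve \<open>s j\<close> are therefore one and
  the same condition, of the form \<open>t + s j + c \<in> (0, 1]\<close> with \<open>c\<close> independent of \<open>s j\<close>; it holds on
  an interval of length one. Integrating over \<open>s j\<close> first leaves a region with one variable less.
  Once no variable is left, the windows reduce to \<open>t \<in> (0, 1]\<close>.\<close>

lemma emeasure_window_region_laminar:
  assumes "finite J" "finite R" "J \<subseteq> R" "t \<in> {0<..1}"
    and "\<And>j. j \<in> J \<Longrightarrow> j < M j"
    and "\<And>i j. i \<in> J \<Longrightarrow> j \<in> J \<Longrightarrow> i < j \<Longrightarrow> M i \<le> j \<or> M j \<le> M i"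
  shows "emeasure (\<Pi>\<^sub>M j\<in>J. lborel) (window_region J M R t) = 1"
  using assms
proof (induction J arbitrary: R rule: finite_linorder_max_induct)
  case empty
  have "window_region {} M R t = {\<lambda>_. undefined}"
    using empty by (auto simp: window_region_def)
  then show ?case
    by (simp add: PiM_empty)
next
  case (insert j J)
  let ?R = "{p \<in> R. \<not> (j \<le> p \<and> p < M j)}"
  let ?W = "window_region (insert j J) M R t"
  let ?c = "\<lambda>s. \<Sum>i\<in>{i\<in>J. M j \<le> M i}. s i :: real"
  have j: "j \<notin> J" using insert by auto
  have Mj: "j < M j" "j \<in> R" using insert by auto
  have fibre: "{x. s(j := x) \<in> ?W} =
      (if s \<in> window_region J M ?R t then {x. t + (x + ?c s) \<in> {0<..1}} else {})"
    if s: "s \<in> J \<rightarrow>\<^sub>E UNIV" for s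
  proof -
    have outside: "(\<Sum>i\<in>{i\<in>insert j J. i \<le> p \<and> p < M i}. (s(j := x)) i)
        = (\<Sum>i\<in>{i\<in>J. i \<le> p \<and> p < M i}. s i)" if "\<not> (j \<le> p \<and> p < M j)" for p x
      using that j by (intro sum.cong) auto
    have inside: "(\<Sum>i\<in>{i\<in>insert j J. i \<le> p \<and> p < M i}. (s(j := x)) i) = x + ?c s"
      if "j \<le> p \<and> p < M j" for p x
    proof -
      have "{i\<in>insert j J. i \<le> p \<and> p < M i} = insert j {i\<in>J. M j \<le> M i}"
        using that insert.hyps insert.prems(5)[of _ j] by fastforce
      then show ?thesis using insert.hyps j by (auto intro!: sum.cong)
    qed
    have partial_sum: "(\<Sum>i\<in>{i\<in>insert j J. i \<le> p \<and> p < M i}. (s(j := x)) i) =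
        (if j \<le> p \<and> p < M j then x + ?c s else (\<Sum>i\<in>{i\<in>J. i \<le> p \<and> p < M i}. s i))" for p x
      using outside[of p x] inside[of p x] by (simp only: split: if_split) blast
    have "s(j := x) \<in> insert j J \<rightarrow>\<^sub>E UNIV" for x using s by (auto simp: PiE_def extensional_def)
    then have "s(j := x) \<in> ?W \<longleftrightarrow> (\<forall>p\<in>R. t + (if j \<le> p \<and> p < M j then x + ?c s
        else (\<Sum>i\<in>{i\<in>J. i \<le> p \<and> p < M i}. s i)) \<in> {0<..1})" for x
      by (simp only: window_region_def mem_Collect_eq partial_sum simp_thms)
    also have "\<dots> x \<longleftrightarrow> s \<in> window_region J M ?R t \<and> t + (x + ?c s) \<in> {0<..1}" for x
      using Mj s by (auto simp: window_region_def)
    finally show ?thesis by auto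
  qed
  have len: "emeasure lborel {x. t + (x + c) \<in> {0<..1}} = 1" for c :: real
  proof -
    have "{x. t + (x + c) \<in> {0<..1}} = {- t - c<..1 - t - c}" by auto
    then show ?thesis by simp
  qed
  have "emeasure (\<Pi>\<^sub>M j\<in>insert j J. lborel) ?W =
      (\<integral>\<^sup>+ s. emeasure lborel {x. s(j := x) \<in> ?W} \<partial>(\<Pi>\<^sub>M j\<in>J. lborel))"
    using insert j by (intro emeasure_PiM_insert window_region_sets) auto
  also have "\<dots> = (\<integral>\<^sup>+ s. indicator (window_region J M ?R t) s \<partial>(\<Pi>\<^sub>M j\<in>J. lborel))"
  proof (intro nn_integral_cong)
    fix s :: "nat \<Rightarrow> real" assume "s \<in> space (\<Pi>\<^sub>M j\<in>J. lborel)"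
    then have "s \<in> J \<rightarrow>\<^sub>E UNIV" by (simp add: space_PiM)
    then show "emeasure lborel {x. s(j := x) \<in> ?W} = indicator (window_region J M ?R t) s"
      by (simp only: fibre len indicator_def emeasure_empty split: if_split) simp
  qed
  also have "\<dots> = emeasure (\<Pi>\<^sub>M j\<in>J. lborel) (window_region J M ?R t)"
    using insert by (intro nn_integral_indicator window_region_sets) auto
  also have "\<dots> = 1"
    using insert.prems insert.hyps by (intro insert.IH) auto
  finally show ?case .
qed

text \<open>The region for two variables that cross: \<open>s 1\<close> is present at the positions \<open>1, 2\<close> and \<open>s 2\<close> at
  \<open>2, 3\<close>. Given \<open>s 1\<close>, the two windows for \<open>s 2\<close> are translates of each other by \<open>s 1\<close>, so that
  their intersection has length \<open>1 - \<bar>s 1\<bar>\<close>.\<close>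

lemma emeasure_window_region_crossing:
  assumes t: "t \<in> {0<..1}"
  shows "emeasure (\<Pi>\<^sub>M j\<in>{1,2}. lborel) (window_region {1,2} (\<lambda>j. j + 2) {1..3} t)
    = ennreal (1 / 2 + t - t\<^sup>2)"
proof -
  interpret product_sigma_finite "\<lambda>_::nat. lborel :: real measure" ..
  let ?W = "window_region {1,2} (\<lambda>j. j + 2) {1..3} t"
  have R: "{1..3} = {1,2,3::nat}" by auto
  have sets: "{j \<in> {1,2}. j \<le> 1 \<and> 1 < j + 2} = {1::nat}"
    "{j \<in> {1,2}. j \<le> 2 \<and> 2 < j + 2} = {1,2::nat}"
    "{j \<in> {1,2}. j \<le> 3 \<and> 3 < j + 2} = {2::nat}" by auto
  have W: "?W = {s \<in> {1,2} \<rightarrow>\<^sub>E UNIV. t + s 1 \<in> {0<..1} \<and> t + (s 1 + s 2) \<in> {0<..1} \<and>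
      t + s 2 \<in> {0<..1}}"
    unfolding window_region_def R by (simp only: ball_simps sets) simp
  have fibre: "{x. s(2 := x) \<in> ?W} = (if s 1 \<in> {- t<..1 - t}
      then {max (- t) (- t - s 1)<..min (1 - t) (1 - t - s 1)} else {})"
    if "s \<in> {1} \<rightarrow>\<^sub>E UNIV" for s :: "nat \<Rightarrow> real"
  proof -
    have "s(2 := x) \<in> {1,2} \<rightarrow>\<^sub>E UNIV" for x using that by (auto simp: PiE_def extensional_def)
    then show ?thesis unfolding W by auto
  qed
  have len: "emeasure lborel {max (- t) (- t - s)<..min (1 - t) (1 - t - s)} = ennreal (1 - \<bar>s\<bar>)"
    if "s \<in> {- t<..1 - t}" for s :: real
  proof -
    have "max (- t) (- t - s) \<le> min (1 - t) (1 - t - s)" using that t by auto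
    then show ?thesis by (simp add: max_def min_def abs_if split: if_splits)
  qed
  let ?F = "\<lambda>s::real. s - s * \<bar>s\<bar> / 2"
  have deriv: "(?F has_real_derivative 1 - \<bar>s\<bar>) (at s)" for s
  proof -
    have "((\<lambda>s::real. s * \<bar>s\<bar>) has_field_derivative 2 * \<bar>s\<bar>) (at s)"
    proof (cases "s = 0")
      case True
      have "((\<lambda>h::real. h * \<bar>h\<bar> / h) \<longlongrightarrow> 0) (at 0)"
        by (rule Lim_transform_eventually[of "\<lambda>h. \<bar>h\<bar>"])
           (auto intro!: tendsto_eq_intros simp: eventually_at_filter)
      then show ?thesis using True by (simp add: DERIV_def)
    next
      case False
      then consider "s > 0" | "s < 0" by linarith
      then show ?thesis
      proof cases
        case 1
        have "((\<lambda>s::real. s * s) has_field_derivative 2 * \<bar>s\<bar>) (at s)"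
          using 1 by (auto intro!: derivative_eq_intros)
        then show ?thesis
          by (rule has_field_derivative_transform_within_open[where S = "{0<..}"]) (use 1 in auto)
      next
        case 2
        have "((\<lambda>s::real. - (s * s)) has_field_derivative 2 * \<bar>s\<bar>) (at s)"
          using 2 by (auto intro!: derivative_eq_intros)
        then show ?thesis
          by (rule has_field_derivative_transform_within_open[where S = "{..<0}"]) (use 2 in auto)
      qed
    qed
    from DERIV_diff[OF DERIV_ident DERIV_cdivide[OF this, of 2]]
    show ?thesis by simp
  qed
  have ins: "{1,2} = insert 2 {1::nat}" by auto
  have "emeasure (\<Pi>\<^sub>M j\<in>{1,2}. lborel) ?W =
      (\<integral>\<^sup>+ s. emeasure lborel {x. s(2 := x) \<in> ?W} \<partial>(\<Pi>\<^sub>M j\<in>{1}. lborel))"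
    unfolding ins by (intro emeasure_PiM_insert) (auto intro!: window_region_sets simp flip: ins)
  also have "\<dots> = (\<integral>\<^sup>+ s. ennreal (1 - \<bar>s 1\<bar>) * indicator {- t<..1 - t} (s 1) \<partial>(\<Pi>\<^sub>M j\<in>{1::nat}. lborel))"
  proof (intro nn_integral_cong)
    fix s :: "nat \<Rightarrow> real" assume "s \<in> space (\<Pi>\<^sub>M j\<in>{1}. lborel)"
    then have "s \<in> {1} \<rightarrow>\<^sub>E UNIV" by (simp add: space_PiM)
    note fibre = fibre[OF this]
    show "emeasure lborel {x. s(2 := x) \<in> ?W} =
        ennreal (1 - \<bar>s 1\<bar>) * indicator {- t<..1 - t} (s 1)"
      unfolding fibre
      using len[of "s 1"] by (cases "s 1 \<in> {- t<..1 - t}") auto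
  qed
  also have "\<dots> = (\<integral>\<^sup>+ x. ennreal (1 - \<bar>x\<bar>) * indicator {- t<..1 - t} x \<partial>lborel)"
    by (rule product_nn_integral_singleton) measurable
  \<comment> \<open>The closed interval differs by one point and is the form in which the fundamental theorem applies.\<close>
  also have "\<dots> = (\<integral>\<^sup>+ x. ennreal (1 - \<bar>x\<bar>) * indicator {- t..1 - t} x \<partial>lborel)"
    by (rule nn_integral_cong_AE[OF AE_mp[OF AE_lborel_singleton[of "- t"] AE_I2]])
       (auto simp: indicator_def)
  also have "\<dots> = ennreal (?F (1 - t) - ?F (- t))"
    using t by (intro nn_integral_FTC_Icc) (auto intro: deriv)
  also have "?F (1 - t) - ?F (- t) = 1 / 2 + t - t\<^sup>2"
    using t by (simp add: field_simps power2_eq_square)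
  finally show ?thesis .
qed


section \<open>Noncrossing partitions and the crossing partition of four points\<close>

lemma block_eq:
  assumes "partition_on A \<pi>" "S \<in> \<pi>" "j \<in> S"
  shows "block \<pi> j = S"
  unfolding block_def
  using assms partition_onD2[OF assms(1)] by (intro the_equality) (auto simp: disjoint_def)

lemma block_mem:
  assumes "partition_on A \<pi>" "j \<in> A"
  shows "block \<pi> j \<in> \<pi>" "j \<in> block \<pi> j" "block \<pi> j \<subseteq> A"
proof -
  obtain S where "S \<in> \<pi>" "j \<in> S" using assms by (auto simp: partition_on_def)
  then show "block \<pi> j \<in> \<pi>" "j \<in> block \<pi> j" "block \<pi> j \<subseteq> A"
    using block_eq[OF assms(1)] assms(1) by (auto simp: partition_on_def)
qed

lemma J_set_eq:
  assumes "partition_on {1..n} \<pi>"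
  shows "J_set \<pi> = {j \<in> {1..n}. j < Max (block \<pi> j)}"
proof -
  have "j \<in> J_set \<pi> \<longleftrightarrow> j \<in> {1..n} \<and> j \<noteq> Max (block \<pi> j)" for j
    using assms block_eq[OF assms] block_mem[OF assms]
    unfolding J_set_def partition_on_def
    by (metis (no_types, lifting) DiffD1 DiffD2 DiffI UN_E UN_I Union_iff singletonD singletonI)
  moreover have "j \<le> Max (block \<pi> j)" if "j \<in> {1..n}" for j
    using block_mem[OF assms that] finite_subset[OF _ finite_atLeastAtMost] by (intro Max_ge) blast+
  ultimately show ?thesis by fastforce
qed

text \<open>The block of \<open>j \<le> p\<close> is not contained in \<open>{1..p}\<close> iff its maximum exceeds \<open>p\<close>.\<close>

lemma E_set_eq_window_region:
  assumes "partition_on {1..n} \<pi>"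
  shows "E_set n \<pi> t = window_region (J_set \<pi>) (\<lambda>j. Max (block \<pi> j)) {1..n - 1} t"
proof -
  have "I_set \<pi> p = {j \<in> J_set \<pi>. j \<le> p \<and> p < Max (block \<pi> j)}" if "p \<in> {1..n - 1}" for p
  proof -
    have "\<not> block \<pi> j \<subseteq> {1..p} \<longleftrightarrow> p < Max (block \<pi> j)" if j: "j \<in> {1..p}" for j
    proof -
      have "j \<in> {1..n}" using j \<open>p \<in> {1..n - 1}\<close> by auto
      from block_mem[OF assms this] assms
      have "block \<pi> j \<subseteq> {1..n}" "j \<in> block \<pi> j" by (auto simp: partition_on_def)
      moreover from this have "finite (block \<pi> j)" by (auto intro: finite_subset)
      ultimately have "p < Max (block \<pi> j) \<longleftrightarrow> (\<exists>i\<in>block \<pi> j. p < i)"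
        by (subst Max_gr_iff) auto
      then show ?thesis using \<open>block \<pi> j \<subseteq> {1..n}\<close> by force
    qed
    then show ?thesis
      using that unfolding I_set_def J_set_eq[OF assms] by fastforce
  qed
  then show ?thesis unfolding E_set_def window_region_def by auto
qed

lemma Lam_one_eq_measure:
  assumes "J_set \<pi> \<noteq> {}"
  shows "Lam n \<pi> (\<lambda>_. 1) t = of_real (measure (\<Pi>\<^sub>M j\<in>J_set \<pi>. lborel) (E_set n \<pi> t))"
proof -
  let ?M = "\<Pi>\<^sub>M j\<in>J_set \<pi>. lborel :: real measure"
  have "Lam n \<pi> (\<lambda>_. 1) t = (LINT s|?M. complex_of_real (indicator (E_set n \<pi> t) s))"
  proof -
    have "indicator (E_set n \<pi> t) s *\<^sub>R
        (\<Prod>p\<in>{1..n-1}. C01_fun 1 (t + (\<Sum>j\<in>I_set \<pi> p. s j))) =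
        complex_of_real (indicator (E_set n \<pi> t) s)" for s
    proof (cases "s \<in> E_set n \<pi> t")
      case True
      then have "(\<Prod>p\<in>{1..n-1}. C01_fun 1 (t + (\<Sum>j\<in>I_set \<pi> p. s j))) = 1"
        by (intro prod.neutral) (auto simp: one_C01.rep_eq E_set_def)
      then show ?thesis using True by simp
    qed simp
    then show ?thesis using assms unfolding Lam_def set_lebesgue_integral_def by simp
  qed
  also have "\<dots> = of_real (measure ?M (E_set n \<pi> t \<inter> space ?M))"
    by (simp add: integral_complex_of_real)
  also have "E_set n \<pi> t \<inter> space ?M = E_set n \<pi> t"
    by (auto simp: E_set_def space_PiM)
  finally show ?thesis .
qed

definition noncrossing :: "nat set set \<Rightarrow> bool"
  where "noncrossing \<pi> \<longleftrightarrow> (\<forall>S\<in>\<pi>. \<forall>T\<in>\<pi>. \<forall>a\<in>S. \<forall>b\<in>T. \<forall>c\<in>S. \<forall>d\<in>T.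
    a < b \<and> b < c \<and> c < d \<longrightarrow> S = T)"

text \<open>If \<open>i < j < max S\<^sub>\<pi>(i) < max S\<^sub>\<pi>(j)\<close>, then \<open>i, max S\<^sub>\<pi>(i)\<close> and \<open>j, max S\<^sub>\<pi>(j)\<close> form a crossing. For
  a noncrossing partition the intervals are thus laminar, and the volume is one.\<close>

lemma Lam_noncrossing:
  assumes "\<pi> \<in> set_partitions n" "noncrossing \<pi>" "t \<in> {0<..1}"
  shows "Lam n \<pi> (\<lambda>_. 1) t = 1"
proof (cases "J_set \<pi> = {}")
  case True
  then show ?thesis using assms(3) by (simp add: Lam_def one_C01.rep_eq)
next
  case False
  from assms(1) have \<pi>: "partition_on {1..n} \<pi>" by (simp add: set_partitions_def)
  let ?M = "\<lambda>j. Max (block \<pi> j)"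
  note J = J_set_eq[OF \<pi>]
  have Max: "?M j \<in> block \<pi> j" "?M j \<le> n" if "j \<in> {1..n}" for j
  proof -
    have "block \<pi> j \<subseteq> {1..n}" using block_mem[OF \<pi> that] \<pi> by (auto simp: partition_on_def)
    moreover have "?M j \<in> block \<pi> j"
      using block_mem[OF \<pi> that] calculation by (intro Max_in) (auto intro: finite_subset)
    ultimately show "?M j \<in> block \<pi> j" "?M j \<le> n" by auto
  qed
  have "emeasure (\<Pi>\<^sub>M j\<in>J_set \<pi>. lborel) (E_set n \<pi> t) = 1"
    unfolding E_set_eq_window_region[OF \<pi>]
  proof (rule emeasure_window_region_laminar)
    show "J_set \<pi> \<subseteq> {1..n - 1}"
    proof
      fix j assume "j \<in> J_set \<pi>"
      then show "j \<in> {1..n - 1}" using Max(2)[of j] by (auto simp: J)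
    qed
    fix i j assume ij: "i \<in> J_set \<pi>" "j \<in> J_set \<pi>" "i < j"
    show "?M i \<le> j \<or> ?M j \<le> ?M i"
    proof (rule ccontr)
      assume cross: "\<not> ?thesis"
      have "i \<in> {1..n}" "j \<in> {1..n}" using ij(1,2) by (auto simp: J)
      then have "block \<pi> i = block \<pi> j"
        using assms(2)[unfolded noncrossing_def, rule_format,
            of "block \<pi> i" "block \<pi> j" i j "?M i" "?M j"]
          ij(3) cross Max(1) block_mem(1,2)[OF \<pi>] by auto
      with cross show False by simp
    qed
  qed (use assms(3) in \<open>auto simp: J\<close>)
  then show ?thesis using False by (simp add: Lam_one_eq_measure measure_def)
qed

definition crossing4 :: "nat set set"
  where "crossing4 = {{1, 3}, {2, 4}}"

lemma crossing4_partition: "partition_on {1..4} crossing4"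
  by (auto simp: partition_on_def crossing4_def disjoint_def)

lemma crossing4_unique:
  assumes "\<pi> \<in> set_partitions 4" "\<not> noncrossing \<pi>"
  shows "\<pi> = crossing4"
proof -
  from assms(1) have \<pi>: "partition_on {1..4} \<pi>" by (simp add: set_partitions_def)
  then have U: "\<Union>\<pi> = {1..4}" by (simp add: partition_on_def)
  from assms(2) obtain S T a b c d where ST: "S \<in> \<pi>" "T \<in> \<pi>" "S \<noteq> T"
    and abcd: "a \<in> S" "b \<in> T" "c \<in> S" "d \<in> T" "a < b" "b < c" "c < d"
    unfolding noncrossing_def by blast
  have "a \<in> {1..4}" "b \<in> {1..4}" "c \<in> {1..4}" "d \<in> {1..4}"
    using ST abcd U by blast+
  with abcd(5-) have "a = 1" "b = 2" "c = 3" "d = 4" by auto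
  with abcd have in_ST: "1 \<in> S" "3 \<in> S" "2 \<in> T" "4 \<in> T" by auto
  have four: "{1..4} = {1, 2, 3, 4::nat}" by auto
  have disj: "R = R'" if "R \<in> \<pi>" "R' \<in> \<pi>" "x \<in> R" "x \<in> R'" for R R' x
    using that block_eq[OF \<pi>] by metis
  have "S \<subseteq> {1,2,3,4}" "T \<subseteq> {1,2,3,4}" using ST U four by auto
  then have "S = {1,3}" "T = {2,4}" using in_ST disj[OF ST(1,2)] ST(3) by auto
  moreover have "R \<in> {S, T}" if "R \<in> \<pi>" for R
  proof -
    from \<pi> that have "R \<noteq> {}" by (auto simp: partition_on_def)
    then obtain x where x: "x \<in> R" by auto
    then have "x \<in> {1,2,3,4}" using that U four by auto
    then have "x \<in> S \<or> x \<in> T" using in_ST by auto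
    then show ?thesis using disj that x ST by blast
  qed
  ultimately show ?thesis using ST by (auto simp: crossing4_def)
qed

lemma Lam_crossing4:
  assumes "t \<in> {0<..1}"
  shows "Lam 4 crossing4 (\<lambda>_. 1) t = of_real (1 / 2 + t - t\<^sup>2)"
proof -
  note \<pi> = crossing4_partition
  have J: "J_set crossing4 = {1, 2}" by (auto simp: J_set_def crossing4_def)
  have "block crossing4 1 = {1,3}" "block crossing4 2 = {2,4}"
    using block_eq[OF \<pi>] by (auto simp: crossing4_def)
  then have "E_set 4 crossing4 t = window_region {1, 2} (\<lambda>j. j + 2) {1..3} t"
    unfolding E_set_eq_window_region[OF \<pi>] J window_region_def
    by (intro Collect_cong conj_cong ball_cong HOL.refl arg_cong2[where f = "(\<in>)"]
        arg_cong2[where f = "(+)"] sum.cong) auto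
  moreover have "0 \<le> 1 / 2 + t - t\<^sup>2"
  proof -
    have "t * t \<le> t" using mult_left_le[of t t] assms by simp
    then show ?thesis using assms by (simp only: power2_eq_square greaterThanAtMost_iff)
  qed
  ultimately show ?thesis
    using emeasure_window_region_crossing[OF assms] Lam_one_eq_measure[of crossing4 4 t]
    by (simp add: J measure_def)
qed


section \<open>Three moments\<close>

text \<open>The value of \<open>f\<close> at \<open>0\<close> is left free because the formulas for \<open>\<Lambda>\<^sub>\<pi>\<close> are valid on \<open>(0, 1]\<close> only.\<close>

lemma integral01_eq_primitive:
  assumes f: "\<And>t. t \<in> {0<..1} \<Longrightarrow> f t = of_real (g t)"
    and G: "\<And>t. (G has_real_derivative g t) (at t)" and g: "continuous_on UNIV g"
  shows "integral01 f = of_real (G 1 - G 0)"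
proof -
  have "integral01 f = (LINT t|lborel. indicator {0..1} t *\<^sub>R complex_of_real (g t))"
    unfolding integral01_def set_lebesgue_integral_def
    by (rule integral_discrete_difference[where X = "{0}"]) (auto simp: f indicator_def)
  also have "\<dots> = of_real (G 1) - of_real (G 0)"
  proof (rule integral_FTC_Icc)
    show "continuous_on {0..1} (\<lambda>t. complex_of_real (g t))"
      using g by (intro continuous_on_of_real) (rule continuous_on_subset[OF _ subset_UNIV])
    show "((\<lambda>t. complex_of_real (G t)) has_vector_derivative complex_of_real (g t)) (at t within {0..1})" for t
      using has_field_derivative_at_within[OF G]
      by (rule has_vector_derivative_of_real)
  qed simp
  finally show ?thesis by simp
qed

lemma tau_one: "tau 1 = 1"
  unfolding tau_def
  by (subst integral01_eq_primitive[where g = "\<lambda>_. 1" and G = "\<lambda>t. t"])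
     (auto simp: one_C01.rep_eq)

lemma integral01_Lam:
  assumes "\<pi> \<in> set_partitions n" "noncrossing \<pi>"
  shows "integral01 (\<lambda>t. Lam n \<pi> (\<lambda>_. 1) t * C01_fun 1 t) = 1"
  by (subst integral01_eq_primitive[where g = "\<lambda>_. 1" and G = "\<lambda>t. t"])
     (auto simp: one_C01.rep_eq Lam_noncrossing[OF assms])

lemma integral01_Lam_crossing4:
  "integral01 (\<lambda>t. Lam 4 crossing4 (\<lambda>_. 1) t * C01_fun 1 t) = 2 / 3"
  by (subst integral01_eq_primitive[where g = "\<lambda>t. 1 / 2 + t - t\<^sup>2" and G = "\<lambda>t. t / 2 + t\<^sup>2 / 2 - t ^ 3 / 3"])
     (auto simp: one_C01.rep_eq Lam_crossing4 intro!: derivative_eq_intros continuous_intros)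

lemma noncrossing_2:
  assumes "\<pi> \<in> set_partitions 2"
  shows "noncrossing \<pi>"
  unfolding noncrossing_def
proof clarify
  fix S T a b c d assume "S \<in> \<pi>" "T \<in> \<pi>" "a \<in> S" "b \<in> T" "c \<in> S" "d \<in> T" "a < b" "b < c" "c < d"
  moreover from assms have "\<Union>\<pi> = {1..2}" by (auto simp: set_partitions_def partition_on_def)
  ultimately have "a \<in> {1..2}" "d \<in> {1..2}" by blast+
  with \<open>a < b\<close> \<open>b < c\<close> \<open>c < d\<close> show "S = T" by auto
qed

lemma finite_set_partitions: "finite (set_partitions n)"
  by (simp add: set_partitions_def finitely_many_partition_on)

lemma sum_cscale: "(\<Sum>i\<in>A. c i *\<^sub>C a) = (\<Sum>i\<in>A. c i) *\<^sub>C (a :: 'a::star_algebra)"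
proof -
  have zero: "0 *\<^sub>C a = 0" using cscale_add_left[of 0 0 a] by simp
  show ?thesis by (induction A rule: infinite_finite_induct) (simp_all add: zero cscale_add_left)
qed

lemma Gam_one: "Gam \<pi> (\<lambda>_. 1) = 1"
  by (simp add: Gam_def tau_one cscale_one)

text \<open>If the block of \<open>m\<close> is not the block of \<open>1\<close>, it contributes the factor \<open>\<tau>(f) = 0\<close>.\<close>

lemma Gam_single:
  assumes "\<pi> \<in> set_partitions n" "1 \<le> m" "m \<le> n" "tau f = 0"
  shows "Gam \<pi> (\<lambda>j. if j = m then f else 1) = (if m \<in> block \<pi> 1 then f else 0)"
proof -
  from assms(1) have \<pi>: "partition_on {1..n} \<pi>" by (simp add: set_partitions_def)
  have fin: "finite S" if "S \<in> \<pi>" for S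
    by (rule finite_subset[of S "{1..n}"]) (use that \<pi> in \<open>auto simp: partition_on_def\<close>)
  have P: "(\<Prod>j\<in>S. if j = m then f else 1) = (if m \<in> S then f else 1)" if "S \<in> \<pi>" for S
    using fin[OF that] by (simp add: prod.delta)
  have B1: "block \<pi> 1 \<in> \<pi>" using block_mem[OF \<pi>, of 1] assms(2,3) by simp
  have Bm: "block \<pi> m \<in> \<pi>" "m \<in> block \<pi> m" using block_mem[OF \<pi>, of m] assms(2,3) by auto
  have fin\<pi>: "finite \<pi>" using \<pi> by (auto intro: finite_elements)
  show ?thesis
  proof (cases "m \<in> block \<pi> 1")
    case True
    have "m \<notin> S" if "S \<in> \<pi> - {block \<pi> 1}" for S
      using that True block_eq[OF \<pi> B1 True] block_eq[OF \<pi>, of S m] by auto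
    then have "(\<Prod>S\<in>\<pi> - {block \<pi> 1}. tau (\<Prod>j\<in>S. if j = m then f else 1)) = 1"
      by (intro prod.neutral) (auto simp: P tau_one)
    then show ?thesis using True by (simp add: Gam_def P[OF B1] cscale_one del: One_nat_def)
  next
    case False
    then have "block \<pi> m \<in> \<pi> - {block \<pi> 1}" using Bm by auto
    then have "(\<Prod>S\<in>\<pi> - {block \<pi> 1}. tau (\<Prod>j\<in>S. if j = m then f else 1)) = 0"
      using fin\<pi> Bm assms(4) by (intro prod_zero) (auto intro!: bexI[of _ "block \<pi> m"] simp: P)
    then show ?thesis
      using False cscale_add_left[of 0 0 "1::C01"] by (simp add: Gam_def P[OF B1] del: One_nat_def)
  qed
qed

lemma sorted_list_of_initial_segments: "sorted_list_of_set {Suc 0..4} = [1,2,3,4]"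
  "sorted_list_of_set {Suc 0..2} = [1,2]"
proof -
  have "{Suc 0..4} = {1..<5}" "{Suc 0..2} = {1..<3}" by auto
  then show "sorted_list_of_set {Suc 0..4} = [1,2,3,4]" "sorted_list_of_set {Suc 0..2} = [1,2]"
    by (simp_all only: sorted_list_of_set_range) (simp_all add: upt_rec)
qed

lemma moment_Q:
  assumes "moments_X_Xstar E"
  shows "E (X * star X * X * star X) = of_nat (card (set_partitions 2)) *\<^sub>C 1"
proof -
  have "E (ordered_prod (\<lambda>i. coef 1 * X * coef 1 * star X) {1..2}) =
       (\<Sum>\<pi>\<in>set_partitions 2.
          integral01 (\<lambda>t. Lam 2 \<pi> (\<lambda>p. 1) t * C01_fun 1 t) *\<^sub>C Gam \<pi> (\<lambda>j. 1))"
    using assms[unfolded moments_X_Xstar_def, rule_format, of 2 "\<lambda>_. 1"] by simp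
  also have "\<dots> = (\<Sum>\<pi>\<in>set_partitions 2. 1 *\<^sub>C 1)"
    by (intro sum.cong HOL.refl) (simp add: integral01_Lam noncrossing_2 Gam_one)
  also have "\<dots> = (\<Sum>\<pi>\<in>set_partitions 2. 1) *\<^sub>C 1" by (rule sum_cscale)
  finally show ?thesis
    by (simp add: ordered_prod_def sorted_list_of_initial_segments coef_one mult.assoc)
qed

text \<open>The partitions that contribute are those in which \<open>1\<close> and \<open>3\<close> lie in the same block. Each of
  them contributes \<open>f\<close>, except for the crossing one, which contributes \<open>2/3 f\<close>.\<close>

lemma moment_QfQ:
  assumes "moments_X_Xstar E" "tau f = 0"
  obtains N :: nat where
    "E (X * star X * X * star X * coef f * X * star X * X * star X) = (of_nat N + 2 / 3) *\<^sub>C f"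
proof -
  define b where "b i = (if i = 5 then f else 1)" for i :: nat
  define A where "A = {\<pi> \<in> set_partitions 4. 3 \<in> block \<pi> 1}"
  define v where "v \<pi> = integral01 (\<lambda>t. Lam 4 \<pi> (\<lambda>_. 1) t * C01_fun 1 t)" for \<pi>
  have fin: "finite A" by (simp add: A_def finite_set_partitions)
  have cr: "crossing4 \<in> A"
    using block_eq[OF crossing4_partition, of "{1,3}" 1] crossing4_partition
    by (simp add: A_def set_partitions_def) (simp add: crossing4_def)
  have b_even: "b (2 * p) = 1" for p
  proof -
    have "2 * p \<noteq> 5" by presburger
    then show ?thesis by (simp add: b_def)
  qed
  have b_odd: "b (2 * j - 1) = (if j = 3 then f else 1)" for j
  proof -
    have "2 * j - 1 = 5 \<longleftrightarrow> j = 3" by presburger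
    then show ?thesis by (simp add: b_def)
  qed
  have "E (ordered_prod (\<lambda>i. coef (b (2*i - 1)) * X * coef (b (2*i)) * star X) {1..4}) =
       (\<Sum>\<pi>\<in>set_partitions 4.
          integral01 (\<lambda>t. Lam 4 \<pi> (\<lambda>p. b (2*p)) t * C01_fun (b (2*4)) t)
            *\<^sub>C Gam \<pi> (\<lambda>j. b (2*j - 1)))"
    using assms(1)[unfolded moments_X_Xstar_def, rule_format, of 4 b] by simp
  also have "\<dots> = (\<Sum>\<pi>\<in>set_partitions 4. if 3 \<in> block \<pi> 1 then v \<pi> *\<^sub>C f else 0)"
    unfolding b_even b_odd v_def
    by (intro sum.cong HOL.refl) (use cscale_add_right[of _ 0 "0::C01"] in \<open>auto simp: Gam_single assms(2)\<close>)
  also have "\<dots> = (\<Sum>\<pi>\<in>A. v \<pi> *\<^sub>C f)"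
    by (simp add: A_def sum.inter_filter finite_set_partitions)
  also have "\<dots> = (\<Sum>\<pi>\<in>A. v \<pi>) *\<^sub>C f" by (rule sum_cscale)
  also have "(\<Sum>\<pi>\<in>A. v \<pi>) = v crossing4 + (\<Sum>\<pi>\<in>A - {crossing4}. v \<pi>)"
    by (rule sum.remove[OF fin cr])
  also have "(\<Sum>\<pi>\<in>A - {crossing4}. v \<pi>) = of_nat (card (A - {crossing4}))"
    using crossing4_unique by (subst sum.cong[OF HOL.refl, of _ v "\<lambda>_. 1"])
      (auto simp: v_def A_def intro!: integral01_Lam)
  finally have "E (ordered_prod (\<lambda>i. coef (b (2*i - 1)) * X * coef (b (2*i)) * star X) {1..4}) =
      (of_nat (card (A - {crossing4})) + 2 / 3) *\<^sub>C f"
    by (simp add: v_def integral01_Lam_crossing4 add.commute)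
  then show thesis
    by (intro that[of "card (A - {crossing4})"])
      (simp add: ordered_prod_def sorted_list_of_initial_segments b_def coef_one mult.assoc)
qed

text \<open>All noncrossing partitions contribute the constant \<open>1\<close>, and the crossing one makes the moment
  depend on \<open>t\<close>.\<close>

lemma moment_P:
  assumes "moments_Xstar_X E"
  obtains N :: nat where "\<And>t. t \<in> {0<..1} \<Longrightarrow>
    C01_fun (E (star X * X * star X * X * star X * X * star X * X)) t = of_real (of_nat N + 1 / 2 + t - t\<^sup>2)"
proof -
  have cr: "crossing4 \<in> set_partitions 4"
    using crossing4_partition by (simp add: set_partitions_def)
  have "C01_fun (E (ordered_prod (\<lambda>i. coef 1 * star X * coef 1 * X) {1..4})) t =
      of_real (of_nat (card (set_partitions 4 - {crossing4})) + 1 / 2 + t - t\<^sup>2)"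
    if t: "t \<in> {0<..1}" for t
  proof -
    have "C01_fun (E (ordered_prod (\<lambda>i. coef 1 * star X * coef 1 * X) {1..4})) t =
       (\<Sum>\<pi>\<in>set_partitions 4. C01_fun 1 t * Lam 4 \<pi> (\<lambda>p. 1) t * tau (Gam \<pi> (\<lambda>j. 1)))"
      using assms[unfolded moments_Xstar_X_def, rule_format, of 4 t "\<lambda>_. 1"] t by simp
    also have "\<dots> = (\<Sum>\<pi>\<in>set_partitions 4. Lam 4 \<pi> (\<lambda>p. 1) t)"
      using t by (simp add: one_C01.rep_eq Gam_one tau_one)
    also have "\<dots> = Lam 4 crossing4 (\<lambda>p. 1) t + (\<Sum>\<pi>\<in>set_partitions 4 - {crossing4}. Lam 4 \<pi> (\<lambda>p. 1) t)"
      by (rule sum.remove[OF finite_set_partitions cr])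
    also have "(\<Sum>\<pi>\<in>set_partitions 4 - {crossing4}. Lam 4 \<pi> (\<lambda>p. 1) t) =
        of_nat (card (set_partitions 4 - {crossing4}))"
      using crossing4_unique t
      by (subst sum.cong[OF HOL.refl, of _ _ "\<lambda>_. 1"]) (auto intro!: Lam_noncrossing)
    finally show ?thesis using t by (simp add: Lam_crossing4)
  qed
  moreover have "ordered_prod (\<lambda>i. coef 1 * star X * coef 1 * X) {1..4} =
      star X * X * star X * X * star X * X * star X * X"
    by (simp add: ordered_prod_def sorted_list_of_initial_segments coef_one mult.assoc)
  ultimately show thesis by (intro that) simp
qed

text \<open>On \<open>(0, 1]\<close> the function \<open>f\<close> is \<open>t - t\<^sup>2 - 1/6\<close>, whatever the constant in \<open>h\<close> is.\<close>

lemma moment_P_centred: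
  assumes "moments_Xstar_X E"
    and h: "h = E (star X * X * star X * X * star X * X * star X * X)" and f: "f = h - tau h *\<^sub>C 1"
  shows "tau f = 0" "tau (f * f) \<noteq> 0"
proof -
  obtain N :: nat where N: "\<And>t. t \<in> {0<..1} \<Longrightarrow>
      C01_fun h t = of_real (of_nat N + 1 / 2 + t - t\<^sup>2)"
    using moment_P[OF assms(1)] unfolding h by blast
  have tau_h: "tau h = of_real (of_nat N + 2 / 3)"
    unfolding tau_def
    by (subst integral01_eq_primitive[where g = "\<lambda>t. of_nat N + 1 / 2 + t - t\<^sup>2"
          and G = "\<lambda>t. (of_nat N + 1 / 2) * t + t\<^sup>2 / 2 - t ^ 3 / 3"])
       (auto simp: N intro!: derivative_eq_intros continuous_intros)
  have f_t: "C01_fun f t = of_real (t - t\<^sup>2 - 1 / 6)" if "t \<in> {0<..1}" for t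
    using that by (simp add: f minus_C01.rep_eq cscale_C01.rep_eq one_C01.rep_eq N tau_h)
  show "tau f = 0"
    unfolding tau_def
    by (subst integral01_eq_primitive[where g = "\<lambda>t. t - t\<^sup>2 - 1 / 6"
          and G = "\<lambda>t. t\<^sup>2 / 2 - t ^ 3 / 3 - t / 6"])
       (auto simp: f_t intro!: derivative_eq_intros continuous_intros)
  have "tau (f * f) = of_real (1 / 180)"
    unfolding tau_def
    by (subst integral01_eq_primitive[where g = "\<lambda>t. (t - t\<^sup>2 - 1 / 6)\<^sup>2"
          and G = "\<lambda>t. t ^ 5 / 5 - t ^ 4 / 2 + 4 / 9 * t ^ 3 - t\<^sup>2 / 6 + t / 36"])
       (auto simp: f_t times_C01.rep_eq power2_eq_square power3_eq_cube power4_eq_xxxx field_simps eval_nat_numeral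
          intro!: derivative_eq_intros continuous_intros)
  then show "tau (f * f) \<noteq> 0" by (simp only: of_real_eq_0_iff)
qed

lemma coefficient_nonzero: "of_nat N + 2 / 3 - of_nat K * of_nat K \<noteq> (0 :: complex)"
proof
  assume "of_nat N + 2 / 3 - of_nat K * of_nat K = (0 :: complex)"
  then have "of_nat (3 * N + 2) = (of_nat (3 * (K * K)) :: complex)"
    by (simp add: field_simps)
  then have "3 * N + 2 = 3 * (K * K)" by (simp only: of_nat_eq_iff)
  then show False by presburger
qed


section \<open>Failure of scalar R-diagonality\<close>

theorem proposition4p12:
  fixes E :: "ncpoly \<Rightarrow> C01"
  assumes "conditional_expectation coef E"
    and "selfadjoint_map E"
    and "R_diagonal coef E X"
    and "moments_Xstar_X E"
    and "moments_X_Xstar E"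
  shows "\<not> R_diagonal scalar (tau \<circ> E) X"
proof
  assume scalar_R: "R_diagonal scalar (tau \<circ> E) X"
  have E_add: "E (a + b) = E a + E b" for a b
    using assms(1) by (auto simp: conditional_expectation_def clinear_def)
  have E_diff: "E (a - b) = E a - E b" for a b
    using E_add[of "a - b" b] by simp
  have E_coef: "E (coef d) = d" for d
    using assms(1) by (auto simp: conditional_expectation_def)
  have E_left: "E (coef d * a) = d * E a" for d a
    using assms(1) coef_one unfolding conditional_expectation_def by (metis mult_1_right)
  have E_right: "E (a * coef d) = E a * d" for d a
    using assms(1) coef_one unfolding conditional_expectation_def by (metis mult_1_left)
  have coef_cscale: "coef (z *\<^sub>C d) = z *\<^sub>C coef d" for z d
    using star_hom_coef by (rule star_hom_simps)
  have cscale_zero [simp]: "z *\<^sub>C (0 :: C01) = 0" for z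
    using cscale_add_right[of z 0 "0 :: C01"] by simp
  have tau_cscale: "tau (z *\<^sub>C d) = z * tau d" for z d
    by (simp add: tau_def integral01_def cscale_C01.rep_eq)

  define Q where "Q = X * star X * X * star X"
  define P where "P = star X * X * star X * X * star X * X * star X * X"
  define h where "h = E P"
  define f where "f = h - tau h *\<^sub>C 1"
  define K :: complex where "K = of_nat (card (set_partitions 2))"
  define q where "q = Q - coef (K *\<^sub>C 1)"
  define p where "p = P - coef h"
  have tau_f: "tau f = 0" and tau_ff: "tau (f * f) \<noteq> 0"
    using moment_P_centred[OF assms(4) h_def[unfolded P_def] f_def] by auto
  have E_Q: "E Q = K *\<^sub>C 1"
    unfolding Q_def K_def by (rule moment_Q[OF assms(5)])
  obtain N :: nat where N: "E (Q * coef f * Q) = (of_nat N + 2 / 3) *\<^sub>C f"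
    using moment_QfQ[OF assms(5) tau_f] by (metis Q_def mult.assoc)
  define \<gamma> where "\<gamma> = of_nat N + 2 / 3 - K * K"

  have E_q: "E q = 0" and E_p: "E p = 0"
    by (simp_all add: q_def p_def E_diff E_Q E_coef h_def)
  let ?q = "[(1, One), (1, Star), (1, One), (1, Star)]"
  let ?qdq = "\<lambda>d. [(1, One), (1, Star), (1, One), (1, Star), (d, One), (1, Star), (1, One), (1, Star)]"
  let ?p = "\<lambda>d. [(d, Star), (1, One), (1, Star), (1, One), (1, Star), (1, One), (1, Star), (1, One)]"
  have words: "word coef X ?q = Q" "word coef X (?p d) = coef d * P"
    "word coef X (?qdq d) = Q * coef d * Q" for d
    by (simp_all add: word_def coef_one Q_def P_def mult.assoc)
  \<comment> \<open>The products of centred words that vanish by \<open>B\<close>-valued R-diagonality.\<close>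
  have qp: "E (q * p) = 0"
    using R_diagonal_words[OF assms(3), of "[?q, ?p 1]"]
    by (simp add: words E_left E_Q q_def p_def h_def coef_one)
  have qp': "E (q * coef d * p) = 0" for d
    using R_diagonal_words[OF assms(3), of "[?q, ?p d]"]
    by (simp add: words E_left E_Q q_def p_def h_def coef_mult right_diff_distrib mult.assoc)
  have qpq: "E (q * p * q) = 0"
    using R_diagonal_words[OF assms(3), of "[?q, ?p 1, ?q]"]
    by (simp add: words E_left E_Q q_def p_def h_def coef_one mult.assoc)
  have qpqp: "E (q * p * q * p) = 0"
    using R_diagonal_words[OF assms(3), of "[?q, ?p 1, ?q, ?p 1]"]
    by (simp add: words E_left E_Q q_def p_def h_def coef_one mult.assoc)
  have QfQp: "E (Q * coef f * Q * p) = 0"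
    using R_diagonal_words[OF assms(3), of "[?qdq f, ?p 1]"]
    by (simp add: words E_left E_coef p_def h_def coef_one left_diff_distrib E_diff mult.assoc)
  \<comment> \<open>The factor \<open>q f q\<close> is not a word minus its expectation. This expansion expresses it by
      \<open>Q f Q\<close>, whose moment is known, and by terms with fewer factors \<open>q\<close>.\<close>
  have QfQ: "Q * coef f * Q = q * coef f * q + q * coef (f * (K *\<^sub>C 1)) + coef (K *\<^sub>C 1 * f) * q
      + coef (K *\<^sub>C 1 * f * (K *\<^sub>C 1))"
    unfolding q_def coef_mult by (simp add: algebra_simps)
  have qfq: "E (q * coef f * q) = \<gamma> *\<^sub>C f"
  proof -
    have "(of_nat N + 2 / 3) *\<^sub>C f = E (q * coef f * q) + (K * K) *\<^sub>C f"
      using N[symmetric] unfolding QfQ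
      by (simp add: E_add E_left E_right E_q E_coef mult_cscale_left mult_cscale_right cscale_cscale)
    moreover have "(of_nat N + 2 / 3) *\<^sub>C f = \<gamma> *\<^sub>C f + (K * K) *\<^sub>C f"
      by (simp add: \<gamma>_def flip: cscale_add_left)
    ultimately show ?thesis by (metis add_right_cancel)
  qed
  have qfqp: "E (q * coef f * q * p) = 0"
  proof -
    have "E (Q * coef f * Q * p) = E (q * coef f * q * p) + E (q * coef (f * (K *\<^sub>C 1)) * p)
        + E (coef (K *\<^sub>C 1 * f) * (q * p)) + E (coef (K *\<^sub>C 1 * f * (K *\<^sub>C 1)) * p)"
      unfolding QfQ by (simp only: ring_distribs E_add mult.assoc)
    then show ?thesis by (simp add: QfQp qp' E_left qp E_p)
  qed

  have scalar_words: "word scalar X [(1, One), (1, Star), (1, One), (1, Star)] = Q"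
    "word scalar X [(1, Star), (1, One), (1, Star), (1, One), (1, Star), (1, One), (1, Star), (1, One)] = P"
    by (simp_all add: word_def cscale_one Q_def P_def mult.assoc)
  \<comment> \<open>Centring with respect to the two expectations agrees for \<open>Q\<close> but differs by \<open>f\<close> for \<open>P\<close>.\<close>
  have "Q - scalar (tau (E Q)) = q"
    by (simp add: q_def E_Q tau_cscale tau_one coef_cscale coef_one)
  moreover have "P - scalar (tau (E P)) = p + coef f"
  proof -
    have "coef f + scalar (tau h) = coef h"
      by (simp add: f_def coef_one flip: coef_cscale coef_add coef_one)
    then show ?thesis by (simp add: p_def h_def algebra_simps)
  qed
  ultimately have "tau (E (q * (p + coef f) * q * (p + coef f))) = 0"
    using R_diagonal_words[OF scalar_R, of "[[(1, One), (1, Star), (1, One), (1, Star)],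
      [(1, Star), (1, One), (1, Star), (1, One), (1, Star), (1, One), (1, Star), (1, One)],
      [(1, One), (1, Star), (1, One), (1, Star)],
      [(1, Star), (1, One), (1, Star), (1, One), (1, Star), (1, One), (1, Star), (1, One)]]"]
    by (simp add: scalar_words mult.assoc)
  moreover have "E (q * (p + coef f) * q * (p + coef f)) = \<gamma> *\<^sub>C (f * f)"
  proof -
    have "q * (p + coef f) * q * (p + coef f) =
        q * p * q * p + q * p * q * coef f + q * coef f * q * p + q * coef f * q * coef f"
      by (simp add: algebra_simps)
    then show ?thesis by (simp add: E_add E_right qpqp qpq qfqp qfq mult_cscale_left)
  qed
  ultimately show False
    using tau_ff coefficient_nonzero[of N "card (set_partitions 2)"] by (simp add: \<gamma>_def K_def tau_cscale)
qed

end
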